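(* Let $n,m,L,\phi\in\mathbb{N}$ and consider the linear $\phi$-periodic system $x(k+1)=A(k)x(k)+B(k)u(k)$ with $A(k)\in\mathbb{R}^{n\times n}$, $B(k)\in\mathbb{R}^{n\times m}$, $A(k+\phi)=A(k)$, $B(k+\phi)=B(k)$ for all $k\ge0$. Let $X(k)\in\mathbb{R}^{n\times L}$, $k=0,\dots,\phi$, and $U(k)\in\mathbb{R}^{m\times L}$, $k=0,\dots,\phi-1$, be data matrices formed from input-state data of this system (see context), and suppose that $$\mathrm{rank}\begin{bmatrix}X(k)\\ U(k)\end{bmatrix}=n+m,\qquad k=0,\dots,\phi-1.$$ Let $Q(k)=Q(k)^\top\succeq0$ and $R(k)=R(k)^\top\succ0$ with $Q(k+\phi)=Q(k)$, $R(k+\phi)=R(k)$ for all $k\ge0$. Then the optimal state feedback gain sequence solving the infinite-horizon LQR problem (see context) with $u^*(k)=K^*(k)x(k)$ is given by $$K^*(k)=U(k)H^*(k)S^*(k)^{-1},\quad k=0,\dots,\phi-1,\qquad K^*(k+n_p\phi)=K^*(k)\ \text{ for all integers } n_p\ge0,$$ where $H^*(k)$ and $S^*(k)$ are the solution of the semidefinite programme $$\min_{\mathcal S,\mathcal H,\mathcal O}\ \sum_{k=0}^{\phi-1}\Big(\mathrm{Tr}\big(Q(k)S(k)\big)+\mathrm{Tr}\big(O(k)\big)\Big)$$ subject to $S(0)\succeq I_n$, $S(\phi)=S(0)$ and, for $k=0,\dots,\phi-1$, $$\begin{bmatrix}S(k+1)-I_n & X(k+1)H(k)\\ H(k)^\top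 X(k+1)^\top & S(k)\end{bmatrix}\succeq0,$$ $$\begin{bmatrix}O(k) & R(k)^{1/2}U(k)H(k)\\ H(k)^\top U(k)^\top R(k)^{1/2} & S(k)\end{bmatrix}\succeq0,$$ $$S(k)=X(k)H(k),$$ with decision variables $\mathcal S=\{S(1),\dots,S(\phi)\}$ (where $S(0)=S(\phi)$), $\mathcal H=\{H(0),\dots,H(\phi-1)\}$, $\mathcal O=\{O(0),\dots,O(\phi-1)\}$, where $S(k)\in\mathbb{R}^{n\times n}$ and $O(k)\in\mathbb{R}^{m\times m}$ are symmetric and $H(k)\in\mathbb{R}^{L\times n}$.
   Context: $\mathrm{Tr}$ denotes the trace; $\succ,\succeq$ refer to the (semi)definite ordering of symmetric matrices. Infinite-horizon LQR problem: for the system $x(k+1)=A(k)x(k)+B(k)u(k)$, find a stabilising control $u^*(k)$, $k\ge0$, minimising $$J(x(0),u(\cdot))=\sum_{k=0}^{\infty}\big(x(k)^\top Q(k)x(k)+u(k)^\top R(k)u(k)\big).$$ Data: the columns of $X(k)=[x_{d,1}(k),\dots,x_{d,L}(k)]$ and $U(k)=[u_{d,1}(k),\dots,u_{d,L}(k)]$ are recorded state and input samples of the system satisfying $x_{d,j}(k+1)=A(k)x_{d,j}(k)+B(k)u_{d,j}(k)$ for $j=1,\dots,L$, $k=0,\dots,\phi-1$; they stem either from an ensemble of $L$ experiments of length $\phi$ or from a single experiment of length $L\phi$ cut into $L$ consecutive periods. Hence $X(k+1)=A(k)X(k)+B(k)U(k)$ for $k=0,\dots,\phi-1$. *)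

theory Defs
  imports "HOL-Analysis.Analysis"
begin

subsection \<open>Semidefinite ordering, square root, block matrices\<close>

definition psd :: "real^'n^'n \<Rightarrow> bool" where
  "psd M \<longleftrightarrow> transpose M = M \<and> (\<forall>x. 0 \<le> x \<bullet> (M *v x))"

definition pd :: "real^'n^'n \<Rightarrow> bool" where
  "pd M \<longleftrightarrow> transpose M = M \<and> (\<forall>x. x \<noteq> 0 \<longrightarrow> 0 < x \<bullet> (M *v x))"

definition loewner_ge :: "real^'n^'n \<Rightarrow> real^'n^'n \<Rightarrow> bool" where
  "loewner_ge M N \<longleftrightarrow> psd (M - N)"

text \<open>A positive semidefinite matrix has exactly one positive semidefinite square root,
  so the choice below is unambiguous for such matrices.\<close>

definition psd_sqrt :: "real^'n^'n \<Rightarrow> real^'n^'n" where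
  "psd_sqrt M = (SOME N. psd N \<and> N ** N = M)"

definition vstack :: "real^'l^'a \<Rightarrow> real^'l^'b \<Rightarrow> real^'l^('a + 'b)" where
  "vstack M N = (\<chi> i. case i of Inl a \<Rightarrow> M $ a | Inr b \<Rightarrow> N $ b)"

definition block22 ::
  "real^'c^'a \<Rightarrow> real^'d^'a \<Rightarrow> real^'c^'b \<Rightarrow> real^'d^'b \<Rightarrow> real^('c + 'd)^('a + 'b)" where
  "block22 M11 M12 M21 M22 = (\<chi> i j.
     case i of
       Inl a \<Rightarrow> (case j of Inl c \<Rightarrow> M11 $ a $ c | Inr d \<Rightarrow> M12 $ a $ d)
     | Inr b \<Rightarrow> (case j of Inl c \<Rightarrow> M21 $ b $ c | Inr d \<Rightarrow> M22 $ b $ d))"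

subsection \<open>The infinite-horizon LQR problem\<close>

primrec state_traj ::
  "(nat \<Rightarrow> real^'n^'n) \<Rightarrow> (nat \<Rightarrow> real^'m^'n) \<Rightarrow> real^'n \<Rightarrow> (nat \<Rightarrow> real^'m) \<Rightarrow> nat \<Rightarrow> real^'n"
  where
    "state_traj A B x0 u 0 = x0"
  | "state_traj A B x0 u (Suc k) = A k *v state_traj A B x0 u k + B k *v u k"

text \<open>The stage costs are nonnegative for the weights of interest, so the series is taken in
  the extended nonnegative reals; divergence means infinite cost.\<close>

definition lqr_cost ::
  "(nat \<Rightarrow> real^'n^'n) \<Rightarrow> (nat \<Rightarrow> real^'m^'n) \<Rightarrow> (nat \<Rightarrow> real^'n^'n) \<Rightarrow> (nat \<Rightarrow> real^'m^'m) \<Rightarrow>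
   real^'n \<Rightarrow> (nat \<Rightarrow> real^'m) \<Rightarrow> ennreal"
  where
    "lqr_cost A B Q R x0 u =
      (\<Sum>k. ennreal (state_traj A B x0 u k \<bullet> (Q k *v state_traj A B x0 u k) + u k \<bullet> (R k *v u k)))"

definition stabilising ::
  "(nat \<Rightarrow> real^'n^'n) \<Rightarrow> (nat \<Rightarrow> real^'m^'n) \<Rightarrow> real^'n \<Rightarrow> (nat \<Rightarrow> real^'m) \<Rightarrow> bool"
  where "stabilising A B x0 u \<longleftrightarrow> state_traj A B x0 u \<longlonglongrightarrow> 0"

text \<open>The minimisation ranges over stabilising controls only: since \<open>Q\<close> is merely positive
  semidefinite, a control that ignores stability may be strictly cheaper.\<close>

definition lqr_optimal ::
  "(nat \<Rightarrow> real^'n^'n) \<Rightarrow> (nat \<Rightarrow> real^'m^'n) \<Rightarrow> (nat \<Rightarrow> real^'n^'n) \<Rightarrow> (nat \<Rightarrow> real^'m^'m) \<Rightarrow>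
   real^'n \<Rightarrow> (nat \<Rightarrow> real^'m) \<Rightarrow> bool"
  where
    "lqr_optimal A B Q R x0 u \<longleftrightarrow>
      stabilising A B x0 u \<and>
      (\<forall>v. stabilising A B x0 v \<longrightarrow> lqr_cost A B Q R x0 u \<le> lqr_cost A B Q R x0 v)"

definition lqr_optimal_gain ::
  "(nat \<Rightarrow> real^'n^'n) \<Rightarrow> (nat \<Rightarrow> real^'m^'n) \<Rightarrow> (nat \<Rightarrow> real^'n^'n) \<Rightarrow> (nat \<Rightarrow> real^'m^'m) \<Rightarrow>
   (nat \<Rightarrow> real^'n^'m) \<Rightarrow> bool"
  where
    "lqr_optimal_gain A B Q R K \<longleftrightarrow>
      (\<forall>x0. \<exists>u. (\<forall>k. u k = K k *v state_traj A B x0 u k) \<and> lqr_optimal A B Q R x0 u)"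

subsection \<open>The data-dependent semidefinite programme\<close>

text \<open>The decision variables are sequences of which only the entries \<open>S 0, \<dots>, S \<phi>\<close>,
  \<open>H 0, \<dots>, H (\<phi> - 1)\<close> and \<open>Y 0, \<dots>, Y (\<phi> - 1)\<close> matter; \<open>Y\<close> is the
  variable bounding the control cost.\<close>

definition sdp_feasible ::
  "nat \<Rightarrow> (nat \<Rightarrow> real^'l^'n) \<Rightarrow> (nat \<Rightarrow> real^'l^'m) \<Rightarrow> (nat \<Rightarrow> real^'m^'m) \<Rightarrow>
   (nat \<Rightarrow> real^'n^'n) \<Rightarrow> (nat \<Rightarrow> real^'n^'l) \<Rightarrow> (nat \<Rightarrow> real^'m^'m) \<Rightarrow> bool"
  where
    "sdp_feasible \<phi> X U R S H Y \<longleftrightarrow>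
      (\<forall>k\<le>\<phi>. transpose (S k) = S k) \<and>
      (\<forall>k<\<phi>. transpose (Y k) = Y k) \<and>
      loewner_ge (S 0) (mat 1) \<and>
      S \<phi> = S 0 \<and>
      (\<forall>k<\<phi>.
        psd (block22 (S (k + 1) - mat 1) (X (k + 1) ** H k)
                     (transpose (H k) ** transpose (X (k + 1))) (S k)) \<and>
        psd (block22 (Y k) (psd_sqrt (R k) ** U k ** H k)
                     (transpose (H k) ** transpose (U k) ** psd_sqrt (R k)) (S k)) \<and>
        S k = X k ** H k)"

definition sdp_objective ::
  "nat \<Rightarrow> (nat \<Rightarrow> real^'n^'n) \<Rightarrow> (nat \<Rightarrow> real^'n^'n) \<Rightarrow> (nat \<Rightarrow> real^'m^'m) \<Rightarrow> real"
  where "sdp_objective \<phi> Q S Y = (\<Sum>k<\<phi>. trace (Q k ** S k) + trace (Y k))"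

definition sdp_solution ::
  "nat \<Rightarrow> (nat \<Rightarrow> real^'l^'n) \<Rightarrow> (nat \<Rightarrow> real^'l^'m) \<Rightarrow> (nat \<Rightarrow> real^'n^'n) \<Rightarrow> (nat \<Rightarrow> real^'m^'m) \<Rightarrow>
   (nat \<Rightarrow> real^'n^'n) \<Rightarrow> (nat \<Rightarrow> real^'n^'l) \<Rightarrow> (nat \<Rightarrow> real^'m^'m) \<Rightarrow> bool"
  where
    "sdp_solution \<phi> X U Q R S H Y \<longleftrightarrow>
      sdp_feasible \<phi> X U R S H Y \<and>
      (\<forall>S' H' Y'. sdp_feasible \<phi> X U R S' H' Y' \<longrightarrow>
         sdp_objective \<phi> Q S Y \<le> sdp_objective \<phi> Q S' Y')"

end

theory Submission
  imports Defs
begin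

text \<open>
  Write \<open>K k = U k ** H k ** matrix_inv (S k)\<close>. The data equation turns \<open>X (k + 1) ** H k\<close> into the closed
  loop \<open>M k = A k + B k ** K k\<close> applied to \<open>S k\<close>, and Schur complements turn the two block constraints into
  \<open>S (k + 1) \<succeq> mat 1 + M k ** S k ** transpose (M k)\<close> and into a bound of the control cost of \<open>S k\<close> by the
  trace of \<open>Y k\<close>. As the data have full row rank, every gain arises. So the programme minimises, over periodic
  gains \<open>K\<close> and supersolutions \<open>S\<close> of the Lyapunov equation of the closed loop, the stationary cost
  \<open>\<Sum>k<\<phi>. trace ((Q k + transpose (K k) ** R k ** K k) ** S k)\<close>
  (\<open>sdp_feasible_imp_lyapunov\<close>, \<open>lyapunov_imp_sdp_feasible\<close>).

  A supersolution \<open>S\<close> certifies stability. By adjointness under the trace pairing, the least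
  value of this cost for a fixed stabilising \<open>K\<close> is the total trace over a period of the cost matrices \<open>P k\<close>
  of \<open>K\<close> (\<open>lyapunov_duality\<close>, \<open>lyapunov_trace_identity\<close>). Hence a minimiser \<open>K\<close> is a stabilising gain that
  cannot be improved. The gain that is greedy for \<open>P\<close> is again stabilising (\<open>policy_improvement_stable\<close>) and
  strictly cheaper unless it equals \<open>K\<close>, so \<open>P\<close> solves the periodic Riccati equation and \<open>K\<close> is its gain.
  Completing the square along trajectories then shows that \<open>K\<close> is optimal among all stabilising controls
  (\<open>stable_riccati_policy_optimal\<close>). This gives \<open>sdp_solution_gain_optimal\<close>.

  With \<open>Q\<close> merely semidefinite the minimum of the programme may fail to be attained; the second claim is that
  it is attained if an optimal gain exists. An optimal gain, possibly aperiodic, stabilises every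
  initial state. Value iteration with unit weights turns this into a stabilising periodic gain
  (\<open>stabilising_periodic_gain_exists\<close>), and policy iteration from there decreases to a Riccati solution \<open>P\<close>
  whose form is the infimum of the cost over all stabilising controls (\<open>riccati_solution_exists\<close>,
  \<open>riccati_lower_bound\<close>). The assumed optimal controls attain this infimum, which forces them to follow the
  Riccati gain (\<open>cheap_control_is_riccati_feedback\<close>). So the Riccati gain drives all states to zero,
  is certified stable, and yields a feasible point whose objective is the total trace of \<open>P\<close>, a lower bound for
  all feasible points (\<open>sdp_objective_ge_riccati\<close>).
\<close>

section \<open>Quadratic forms and the semidefinite order\<close>

definition qf :: "real^'n^'n \<Rightarrow> real^'n \<Rightarrow> real" where
  "qf M x = x \<bullet> (M *v x)"

text \<open>The quadratic form of \<open>congr D P\<close> is the form of \<open>P\<close> composed with \<open>D\<close>.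
  Propagating a covariance \<open>S\<close> by \<open>M\<close>, that is \<open>M ** S ** transpose M\<close>, is
  \<open>congr (transpose M) S\<close>.\<close>

definition congr :: "real^'n^'m \<Rightarrow> real^'m^'m \<Rightarrow> real^'n^'n" where
  "congr D P = transpose D ** P ** D"

lemma scaleR_mult_vec: "(c *\<^sub>R (M::real^'n^'m)) *v x = c *\<^sub>R (M *v x)"
  by (simp add: scaleR_matrix_vector_assoc)

lemma transpose_add: "transpose (M + N) = transpose M + transpose (N::real^'n^'m)"
  by (simp add: transpose_def vec_eq_iff)

lemma transpose_diff: "transpose (M - N) = transpose M - transpose (N::real^'n^'m)"
  by (simp add: transpose_def vec_eq_iff)

lemma transpose_zero: "transpose (0::real^'n^'m) = 0"
  by (simp add: transpose_def vec_eq_iff)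

lemma transpose_congr: "transpose P = P \<Longrightarrow> transpose (congr D P) = congr D P"
  by (simp add: congr_def matrix_transpose_mul matrix_mul_assoc)

lemma qf_simps [simp]:
  "qf (M + N) x = qf M x + qf N x"
  "qf (M - N) x = qf M x - qf N x"
  "qf (c *\<^sub>R M) x = c * qf M x"
  "qf 0 x = 0"
  "qf (mat 1) x = x \<bullet> x"
  "qf M 0 = 0"
  "qf M (c *\<^sub>R x) = c\<^sup>2 * qf M x"
  by (simp_all add: qf_def algebra_simps inner_simps scaleR_mult_vec power2_eq_square)

lemma qf_congr [simp]: "qf (congr D P) x = qf P (D *v x)"
  by (simp add: qf_def congr_def matrix_vector_mul_assoc [symmetric])
    (metis dot_lmul_matrix inner_commute)

lemma sym_form_commute:
  fixes M :: "real^'n^'n"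
  assumes "transpose M = M" shows "x \<bullet> (M *v y) = y \<bullet> (M *v x)"
proof -
  have "x \<bullet> (M *v y) = (transpose M *v x) \<bullet> y" by (simp add: dot_lmul_matrix)
  then show ?thesis by (simp only: assms inner_commute)
qed

lemma qf_add:
  assumes "transpose M = M"
  shows "qf M (x + y) = qf M x + 2 * (x \<bullet> (M *v y)) + qf M y"
  using sym_form_commute[OF assms, of x y] by (simp add: qf_def algebra_simps inner_simps)

text \<open>By polarisation a symmetric matrix is determined by its quadratic form. This, with
  \<open>loewner_ge_iff\<close>, lets almost every matrix (in)equality below be checked on forms.\<close>

lemma sym_matrix_eqI:
  assumes "transpose M = M" "transpose N = N" "\<And>x. qf M x = qf N x"
  shows "M = N"
proof -
  have "x \<bullet> (M *v y) = x \<bullet> (N *v y)" for x y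
    using qf_add[OF assms(1), of x y] qf_add[OF assms(2), of x y] assms(3) by simp
  then show ?thesis
    by (metis matrix_eq vector_eq_rdot inner_commute)
qed

lemma psd_iff: "psd M \<longleftrightarrow> transpose M = M \<and> (\<forall>x. 0 \<le> qf M x)"
  by (simp add: psd_def qf_def)

lemma pd_iff: "pd M \<longleftrightarrow> transpose M = M \<and> (\<forall>x. x \<noteq> 0 \<longrightarrow> 0 < qf M x)"
  by (simp add: pd_def qf_def)

lemma loewner_ge_iff:
  assumes "transpose M = M" "transpose N = N"
  shows "loewner_ge M N \<longleftrightarrow> (\<forall>x. qf N x \<le> qf M x)"
  using assms by (simp add: loewner_ge_def psd_iff transpose_diff)

lemma loewner_geD: "loewner_ge M N \<Longrightarrow> qf N x \<le> qf M x"
  by (simp add: loewner_ge_def psd_iff)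

lemma psd_sym: "psd M \<Longrightarrow> transpose M = M" by (simp add: psd_iff)
lemma psd_nonneg: "psd M \<Longrightarrow> 0 \<le> qf M x" by (simp add: psd_iff)
lemma pd_psd: "pd M \<Longrightarrow> psd M" by (metis pd_iff psd_iff qf_simps(6) order.refl less_imp_le)
lemma psd_zero: "psd 0" by (simp add: psd_iff transpose_zero)
lemma psd_mat1: "psd (mat 1)" by (simp add: psd_iff)
lemma psd_add: "psd M \<Longrightarrow> psd N \<Longrightarrow> psd (M + N)" by (simp add: psd_iff transpose_add)
lemma psd_scaleR: "psd M \<Longrightarrow> 0 \<le> c \<Longrightarrow> psd (c *\<^sub>R M)" by (simp add: psd_iff transpose_scalar)
lemma psd_congr: "psd P \<Longrightarrow> psd (congr D P)" by (simp add: psd_iff transpose_congr)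

lemma pd_add_psd: "pd M \<Longrightarrow> psd N \<Longrightarrow> pd (M + N)"
  by (auto simp: psd_iff pd_iff transpose_add intro: add_pos_nonneg)

lemma loewner_ge_psd: "psd N \<Longrightarrow> loewner_ge M N \<Longrightarrow> psd M"
  using psd_add[of N "M - N"] by (simp add: loewner_ge_def)

lemma pd_of_loewner_ge_mat1: "loewner_ge M (mat 1) \<Longrightarrow> pd M"
  using loewner_ge_psd[OF psd_mat1] 
  by (metis inner_gt_zero_iff less_le_trans loewner_geD pd_iff psd_iff qf_simps(5))

lemma pd_invertible:
  fixes G :: "real^'n^'n"
  assumes "pd G" shows "invertible G"
proof -
  have "G *v x = 0 \<Longrightarrow> x = 0" for x
    using assms unfolding pd_def by (metis inner_zero_right less_irrefl)
  then obtain B where "B ** G = mat 1"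
    using matrix_left_invertible_ker[of G] by auto
  then show ?thesis
    using invertible_def matrix_left_right_inverse by blast
qed

lemma invertible_matrix_inv:
  assumes "invertible (G::real^'n^'n)"
  shows "G ** matrix_inv G = mat 1" "matrix_inv G ** G = mat 1"
  using assms unfolding invertible_def matrix_inv_def
  by (metis (mono_tags, lifting) someI_ex)+

lemma psd_limit:
  assumes "P \<longlonglongrightarrow> L" "\<And>N::nat. psd (P N)"
  shows "psd (L::real^'n^'n)"
proof -
  have ij: "(\<lambda>N. P N $ i $ j) \<longlonglongrightarrow> L $ i $ j" for i j
    using assms(1) by (intro tendsto_intros)
  have "transpose L = L"
  proof (simp add: vec_eq_iff transpose_def, intro allI)
    fix i j
    have "(\<lambda>N. P N $ j $ i) = (\<lambda>N. P N $ i $ j)"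
      using psd_sym[OF assms(2)] by (simp add: fun_eq_iff transpose_def vec_eq_iff)
    then show "L $ j $ i = L $ i $ j"
      using ij[of i j] ij[of j i] LIMSEQ_unique by metis
  qed
  moreover have "0 \<le> qf L x" for x
  proof (rule LIMSEQ_le_const)
    show "(\<lambda>N. qf (P N) x) \<longlonglongrightarrow> qf L x"
      unfolding qf_def matrix_vector_mult_def inner_vec_def
      by (auto intro!: tendsto_intros ij)
  qed (use psd_nonneg[OF assms(2)] in blast)
  ultimately show ?thesis by (simp add: psd_iff)
qed

lemma bounded_bilinear_matrix_mult: "bounded_bilinear ((**) :: real^'n^'m \<Rightarrow> real^'p^'n \<Rightarrow> real^'p^'m)"
  unfolding bilinear_conv_bounded_bilinear [symmetric]
  by (auto simp: bilinear_def linear_iff matrix_add_ldistrib matrix_scalar_ac scalar_matrix_assoc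
      matrix_matrix_mult_def vec_eq_iff sum.distrib sum_distrib_left algebra_simps)

lemma bounded_bilinear_matrix_vector: "bounded_bilinear ((*v) :: real^'n^'m \<Rightarrow> real^'n \<Rightarrow> real^'m)"
  unfolding bilinear_conv_bounded_bilinear [symmetric]
  by (auto simp: bilinear_def linear_iff algebra_simps scaleR_mult_vec)

lemmas matrix_add_rdistrib = bounded_bilinear.add_left[OF bounded_bilinear_matrix_mult]
lemmas matrix_diff_ldistrib = bounded_bilinear.diff_right[OF bounded_bilinear_matrix_mult]
lemmas tendsto_matrix_mult = bounded_bilinear.tendsto[OF bounded_bilinear_matrix_mult]
lemmas tendsto_matrix_vector = bounded_bilinear.tendsto[OF bounded_bilinear_matrix_vector]

lemma tendsto_transpose:
  "(f \<longlongrightarrow> L) F \<Longrightarrow> ((\<lambda>x. transpose (f x :: real^'n^'m)) \<longlongrightarrow> transpose L) F"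
  unfolding transpose_def by (intro tendsto_intros)

lemma tendsto_congr:
  "(f \<longlongrightarrow> D) F \<Longrightarrow> (g \<longlongrightarrow> P) F \<Longrightarrow> ((\<lambda>x. congr (f x) (g x)) \<longlongrightarrow> congr D P) F"
  unfolding congr_def by (intro tendsto_matrix_mult tendsto_transpose)

lemma tendsto_qf: "(f \<longlongrightarrow> M) F \<Longrightarrow> (g \<longlongrightarrow> x) F \<Longrightarrow> ((\<lambda>t. qf (f t) (g t)) \<longlongrightarrow> qf M x) F"
  unfolding qf_def by (intro tendsto_intros tendsto_matrix_vector)

text \<open>The monotone convergence theorem for the semidefinite order: each entry is a
  combination of three values of the quadratic form, and each of those values converges.\<close>

lemma psd_increasing_converges:
  fixes P :: "nat \<Rightarrow> real^'n^'n"
  assumes sym: "\<And>N. transpose (P N) = P N"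
    and inc: "\<And>N. loewner_ge (P (Suc N)) (P N)"
    and bdd: "\<And>x. \<exists>b. \<forall>N. qf (P N) x \<le> b"
  shows "\<exists>L. P \<longlonglongrightarrow> L"
proof -
  have conv: "convergent (\<lambda>N. qf (P N) x)" for x
  proof -
    obtain b where b: "\<And>N. qf (P N) x \<le> b" using bdd by blast
    have "incseq (\<lambda>N. qf (P N) x)"
      using inc loewner_geD by (intro incseq_SucI) blast
    then show ?thesis
      using b incseq_convergent[of "\<lambda>N. qf (P N) x" b] convergentI by blast
  qed
  have "\<exists>l. (\<lambda>N. P N $ i $ j) \<longlonglongrightarrow> l" for i j
  proof -
    have eq: "P N $ i $ j = (qf (P N) (axis i 1 + axis j 1) - qf (P N) (axis i 1) - qf (P N) (axis j 1)) / 2" for N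
      unfolding qf_add[OF sym]
      by (simp add: inner_axis' matrix_vector_mult_basis column_def)
    have "convergent (\<lambda>N. P N $ i $ j)"
      unfolding eq divide_inverse by (intro convergent_mult convergent_diff conv convergent_const)
    then show ?thesis by (simp add: convergent_def)
  qed
  then obtain l where l: "\<And>i j. (\<lambda>N. P N $ i $ j) \<longlonglongrightarrow> l i j" by metis
  have "P \<longlonglongrightarrow> (\<chi> i j. l i j)"
    by (intro vec_tendstoI) (simp add: l)
  then show ?thesis ..
qed

section \<open>Square roots of positive definite matrices\<close>

lemma pd_coercive:
  fixes M :: "real^'n^'n"
  assumes "pd M"
  obtains r where "r > 0" "\<And>x. r * (x \<bullet> x) \<le> qf M x"
proof -
  have cont: "continuous_on (sphere 0 1) (qf M)"
    unfolding qf_def matrix_vector_mult_def by (intro continuous_intros)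
  have "sphere (0::real^'n) 1 \<noteq> {}" by simp
  then obtain x0 where x0: "x0 \<in> sphere 0 1" "\<And>y. y \<in> sphere 0 1 \<Longrightarrow> qf M x0 \<le> qf M y"
    using continuous_attains_inf[OF compact_sphere _ cont] by blast
  show thesis
  proof
    show "0 < qf M x0" using x0(1) assms by (cases "x0 = 0") (auto simp: pd_iff)
    fix x :: "real^'n"
    show "qf M x0 * (x \<bullet> x) \<le> qf M x"
    proof (cases "x = 0")
      case False
      then have "qf M x0 \<le> qf M ((1 / norm x) *\<^sub>R x)"
        by (intro x0(2)) simp
      then show ?thesis using False
        by (simp add: power2_norm_eq_inner[symmetric] field_simps)
    qed simp
  qed
qed

lemma qf_upper:
  fixes M :: "real^'n^'n"
  obtains b where "b > 0" "\<And>x. \<bar>qf M x\<bar> \<le> b * (x \<bullet> x)"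
proof -
  obtain c where c: "c > 0" "\<And>x. norm (M *v x) \<le> norm x * c"
    using bounded_linear.pos_bounded[OF bounded_bilinear.bounded_linear_right[OF bounded_bilinear_matrix_vector]] 
    by blast
  have "\<bar>qf M x\<bar> \<le> c * (x \<bullet> x)" for x
  proof -
    have "\<bar>qf M x\<bar> \<le> norm x * norm (M *v x)" unfolding qf_def by (rule Cauchy_Schwarz_ineq2)
    also have "\<dots> \<le> norm x * (norm x * c)" using c by (intro mult_left_mono) auto
    finally show ?thesis by (simp add: power2_norm_eq_inner[symmetric] power2_eq_square mult_ac)
  qed
  with c show thesis using that by blast
qed

text \<open>A fixed point argument. If \<open>B = mat 1 - (1/t) *\<^sub>R M\<close>
  has operator norm \<open>q < 1\<close>, then \<open>Y \<mapsto> (B + Y\<^sup>2) / 2\<close> is a contraction with constant \<open>q\<close> of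
  the complete set of self-adjoint operators of norm at most \<open>q\<close>. Its fixed point satisfies
  \<open>(1 - Y)\<^sup>2 = 1 - B = M / t\<close>, so that \<open>1 - Y\<close>, rescaled, is the root.\<close>

lemma pd_has_psd_sqrt:
  fixes M :: "real^'n^'n"
  assumes "pd M"
  shows "\<exists>N. psd N \<and> N ** N = M"
proof -
  obtain r where r: "r > 0" "\<And>x. r * (x \<bullet> x) \<le> qf M x" using pd_coercive[OF assms] by blast
  have M_sym: "transpose M = M" using assms by (simp add: pd_iff)
  obtain c where c: "c > 0" "\<And>x. norm (M *v x) \<le> norm x * c"
    using bounded_linear.pos_bounded[OF bounded_bilinear.bounded_linear_right[OF bounded_bilinear_matrix_vector]] 
    by blast
  \<comment> \<open>large enough for \<open>c\<^sup>2 \<le> r * t\<close> and \<open>r < t\<close>, which give \<open>norm B \<le> q\<close> and a real \<open>q\<close>\<close>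
  define t where "t = c\<^sup>2 / r + r"
  have t: "t > 0" "c\<^sup>2 \<le> r * t" "r < t" using r c by (auto simp: t_def field_simps add_pos_pos power2_eq_square)
  define q where "q = sqrt (1 - r / t)"
  have q: "0 \<le> q" "q < 1" using r t by (auto simp: q_def field_simps)
  define B where "B = Blinfun (\<lambda>x. x - (1 / t) *\<^sub>R (M *v x))"
  have B: "blinfun_apply B x = x - (1 / t) *\<^sub>R (M *v x)" for x
    unfolding B_def
    by (subst bounded_linear_Blinfun_apply)
      (auto intro!: bounded_linear_intros bounded_bilinear.bounded_linear_right[OF bounded_bilinear_matrix_vector])
  have normB: "norm B \<le> q"
  proof (rule norm_blinfun_bound)
    fix x
    have "(norm (blinfun_apply B x))\<^sup>2 = x \<bullet> x - 2 / t * qf M x + (norm (M *v x))\<^sup>2 / t\<^sup>2"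
      unfolding B power2_norm_eq_inner
      by (simp add: inner_simps qf_def inner_commute power2_eq_square algebra_simps)
    also have "\<dots> \<le> x \<bullet> x - 2 / t * (r * (x \<bullet> x)) + r / t * (x \<bullet> x)"
    proof -
      have "(norm (M *v x))\<^sup>2 \<le> (norm x * c)\<^sup>2" using c by (intro power_mono) auto
      also have "\<dots> = c\<^sup>2 * (x \<bullet> x)" by (simp add: power_mult_distrib power2_norm_eq_inner)
      also have "\<dots> \<le> (r * t) * (x \<bullet> x)" using t by (intro mult_right_mono) auto
      finally have "(norm (M *v x))\<^sup>2 / t\<^sup>2 \<le> (r * t) * (x \<bullet> x) / t\<^sup>2"
        by (rule divide_right_mono) simp
      also have "\<dots> = r / t * (x \<bullet> x)" using t by (simp add: power2_eq_square)
      finally have "(norm (M *v x))\<^sup>2 / t\<^sup>2 \<le> r / t * (x \<bullet> x)" .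
      moreover have "2 / t * (r * (x \<bullet> x)) \<le> 2 / t * qf M x"
        using r t by (intro mult_left_mono) auto
      ultimately show ?thesis by (intro add_mono diff_left_mono)
    qed
    also have "\<dots> = (q * norm x)\<^sup>2"
      using r t by (simp add: q_def power_mult_distrib power2_norm_eq_inner algebra_simps)
    finally show "norm (blinfun_apply B x) \<le> q * norm x"
      by (rule power2_le_imp_le) (use q in auto)
  qed (use q in auto)
  define F where "F = (\<lambda>Y :: (real^'n) \<Rightarrow>\<^sub>L (real^'n). (1/2) *\<^sub>R (B + (Y o\<^sub>L Y)))"
  define Z where "Z = {Y :: (real^'n) \<Rightarrow>\<^sub>L (real^'n). norm Y \<le> q \<and>
     (\<forall>x y. blinfun_apply Y x \<bullet> y = x \<bullet> blinfun_apply Y y)}"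
  have "closed Z" unfolding Z_def
    by (intro closed_Collect_conj closed_Collect_all closed_Collect_le closed_Collect_eq continuous_intros)
  then have Zc: "complete Z" by (simp add: complete_eq_closed)
  have Z0: "Z \<noteq> {}" using q by (auto simp: Z_def intro!: exI[of _ 0])
  have FZ: "F ` Z \<subseteq> Z"
  proof safe
    fix Y assume Y: "Y \<in> Z"
    have "norm (Y o\<^sub>L Y) \<le> norm Y * norm Y" by (rule norm_blinfun_compose)
    also have "\<dots> \<le> q * 1" using Y q by (intro mult_mono) (auto simp: Z_def)
    finally have "norm (Y o\<^sub>L Y) \<le> q" by simp
    then have "norm (F Y) \<le> q"
      using norm_triangle_ineq[of B "Y o\<^sub>L Y"] normB by (simp add: F_def)
    moreover have "blinfun_apply (F Y) x \<bullet> y = x \<bullet> blinfun_apply (F Y) y" for x y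
    proof -
      have "blinfun_apply Y (blinfun_apply Y x) \<bullet> y = x \<bullet> blinfun_apply Y (blinfun_apply Y y)"
        using Y by (simp add: Z_def)
      moreover have "(M *v x) \<bullet> y = x \<bullet> (M *v y)"
        using sym_form_commute[OF M_sym, of x y] by (simp add: inner_commute)
      ultimately show ?thesis
        by (simp add: F_def blinfun.bilinear_simps B inner_simps)
    qed
    ultimately show "F Y \<in> Z" by (simp add: Z_def)
  qed
  have Flip: "dist (F Y) (F Y') \<le> q * dist Y Y'" if "Y \<in> Z" "Y' \<in> Z" for Y Y'
  proof -
    have "F Y - F Y' = (1/2) *\<^sub>R ((Y o\<^sub>L (Y - Y')) + ((Y - Y') o\<^sub>L Y'))"
      by (rule blinfun_eqI) (simp add: F_def blinfun.bilinear_simps algebra_simps)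
    then have "norm (F Y - F Y') = norm ((Y o\<^sub>L (Y - Y')) + ((Y - Y') o\<^sub>L Y')) / 2" by simp
    also have "\<dots> \<le> (norm Y * norm (Y - Y') + norm (Y - Y') * norm Y') / 2"
      by (intro divide_right_mono norm_triangle_le add_mono norm_blinfun_compose) auto
    also have "\<dots> \<le> (q * norm (Y - Y') + norm (Y - Y') * q) / 2"
      using that by (intro divide_right_mono add_mono mult_mono) (auto simp: Z_def q)
    finally show ?thesis by (simp add: dist_norm)
  qed
  obtain Y where Y: "Y \<in> Z" "F Y = Y"
    using Banach_fix[OF Zc Z0 q FZ] Flip by blast
  define W where "W = matrix (\<lambda>x. x - blinfun_apply Y x)"
  have W: "W *v x = x - blinfun_apply Y x" for x
    unfolding W_def
    by (rule matrix_works)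
      (auto simp: linear_matrix_vector_mul_eq linear_iff blinfun.bilinear_simps algebra_simps)
  have YY: "blinfun_apply Y (blinfun_apply Y x) = 2 *\<^sub>R blinfun_apply Y x - blinfun_apply B x" for x
  proof -
    have "2 *\<^sub>R blinfun_apply (F Y) x = blinfun_apply B x + blinfun_apply Y (blinfun_apply Y x)"
      by (simp add: F_def blinfun.bilinear_simps scaleR_add_right)
    then show ?thesis using Y(2) by simp
  qed
  have "psd W"
    unfolding psd_iff
  proof
    have "x \<bullet> (transpose W *v y) = x \<bullet> (W *v y)" for x y
    proof -
      have "x \<bullet> (transpose W *v y) = y \<bullet> (W *v x)"
        by (simp add: inner_commute[of x] dot_lmul_matrix)
      also have "\<dots> = x \<bullet> (W *v y)"
        using Y(1) by (simp add: W inner_simps Z_def) (metis inner_commute)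
      finally show ?thesis .
    qed
    then show "transpose W = W"
      by (metis matrix_eq vector_eq_rdot inner_commute)
    show "\<forall>x. 0 \<le> qf W x"
    proof
      fix x
      have "x \<bullet> blinfun_apply Y x \<le> norm x * norm (blinfun_apply Y x)" by (rule norm_cauchy_schwarz)
      also have "\<dots> \<le> norm x * (1 * norm x)"
        using Y(1) q norm_blinfun[of Y x] by (intro mult_left_mono order.trans[OF norm_blinfun] mult_right_mono) (auto simp: Z_def)
      finally show "0 \<le> qf W x"
        by (simp add: qf_def W inner_simps power2_norm_eq_inner[symmetric] power2_eq_square)
    qed
  qed
  moreover have "W ** W = (1 / t) *\<^sub>R M"
    unfolding matrix_eq
  proof
    fix x
    show "(W ** W) *v x = ((1 / t) *\<^sub>R M) *v x"
      by (simp add: matrix_vector_mul_assoc[symmetric] W blinfun.bilinear_simps YY B scaleR_mult_vec scaleR_2)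
  qed
  ultimately have "psd (sqrt t *\<^sub>R W)" "(sqrt t *\<^sub>R W) ** (sqrt t *\<^sub>R W) = M"
    using t by (simp_all add: psd_scaleR matrix_scalar_ac flip: scalar_matrix_assoc)
  then show ?thesis by blast
qed

lemma psd_sqrt_of_pd:
  assumes "pd M" shows "psd (psd_sqrt M)" "psd_sqrt M ** psd_sqrt M = M"
  using someI_ex[OF pd_has_psd_sqrt[OF assms]] by (auto simp: psd_sqrt_def)

section \<open>The trace pairing\<close>

lemma trace_scaleR: "trace (c *\<^sub>R (M::real^'n^'n)) = c * trace M"
  by (simp add: trace_def sum_distrib_left)

lemma trace_eq_sum_qf: "trace M = (\<Sum>i\<in>UNIV. qf M (axis i 1))"
  by (simp add: trace_def qf_def inner_axis' matrix_vector_mult_basis column_def)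

lemma trace_psd_nonneg: "psd M \<Longrightarrow> 0 \<le> trace M"
  unfolding trace_eq_sum_qf by (intro sum_nonneg psd_nonneg)

text \<open>For a root \<open>W\<close> of \<open>M\<close> the trace of \<open>M ** N\<close> is the trace of the positive
  semidefinite matrix \<open>W ** N ** W\<close>. As roots are at hand for definite matrices only, \<open>M\<close> is first
  shifted by a small multiple of the identity.\<close>

lemma trace_mult_psd_nonneg:
  assumes "psd M" "psd N"
  shows "0 \<le> trace (M ** N)"
proof (rule field_le_epsilon)
  fix e :: real assume e: "e > 0"
  define d where "d = e / (trace N + 1)"
  have N: "0 \<le> trace N" by (rule trace_psd_nonneg[OF assms(2)])
  have d: "0 < d" "d * trace N \<le> e" using e N by (auto simp: d_def field_simps)
  have "pd (d *\<^sub>R mat 1 + M)"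
    using d(1) assms by (intro pd_add_psd) (auto simp: pd_iff transpose_scalar)
  then obtain W where W: "psd W" "W ** W = d *\<^sub>R mat 1 + M" using pd_has_psd_sqrt by blast
  have "trace ((d *\<^sub>R mat 1 + M) ** N) = trace (W ** (W ** N))"
    by (simp add: W(2)[symmetric] matrix_mul_assoc)
  also have "\<dots> = trace (congr W N)"
    by (subst trace_mul_sym) (simp add: congr_def psd_sym[OF W(1)])
  also have "0 \<le> \<dots>" by (intro trace_psd_nonneg psd_congr assms)
  also have "trace ((d *\<^sub>R mat 1 + M) ** N) = d * trace N + trace (M ** N)"
    by (metis (no_types, opaque_lifting) matrix_mul_lid scalar_matrix_assoc trace_add trace_scaleR
      matrix_add_rdistrib)
  finally show "0 \<le> trace (M ** N) + e" using d by linarith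
qed

lemma trace_mult_mono_right:
  assumes "psd M" "loewner_ge N N'"
  shows "trace (M ** N') \<le> trace (M ** N)"
  using trace_mult_psd_nonneg[OF assms(1), of "N - N'"] assms(2)
  by (simp add: loewner_ge_def matrix_diff_ldistrib trace_sub)

lemma trace_mult_mono_left:
  assumes "psd N" "loewner_ge M M'"
  shows "trace (M' ** N) \<le> trace (M ** N)"
  using trace_mult_mono_right[OF assms] by (simp only: trace_mul_sym[of _ N])

text \<open>Congruence by \<open>D\<close> and congruence by \<open>transpose D\<close> are adjoint for the trace pairing.
  This is the duality between cost matrices and covariances on which the whole development rests.\<close>

lemma trace_congr: "trace (congr D P ** S) = trace (P ** congr (transpose D) S)"
  unfolding congr_def
  using trace_mul_sym[of "transpose D" "P ** D ** S"]
  by (simp add: matrix_mul_assoc)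

text \<open>Pair \<open>M\<close> with the matrix \<open>(x \<bullet> x) *\<^sub>R mat 1 - V\<close>, where \<open>V\<close> is the outer product of \<open>x\<close>
  with itself; it is positive semidefinite by Cauchy-Schwarz.\<close>

lemma qf_le_trace:
  fixes M :: "real^'n^'n"
  assumes "psd M" shows "qf M x \<le> trace M * (x \<bullet> x)"
proof -
  define V :: "real^'n^'n" where "V = (\<chi> i j. x $ i * x $ j)"
  have V: "V *v y = (x \<bullet> y) *\<^sub>R x" for y
    by (simp add: V_def vec_eq_iff matrix_vector_mult_def inner_vec_def sum_distrib_left mult_ac)
  have "psd ((x \<bullet> x) *\<^sub>R mat 1 - V)"
    unfolding psd_iff
  proof
    show "transpose ((x \<bullet> x) *\<^sub>R mat 1 - V) = (x \<bullet> x) *\<^sub>R mat 1 - V"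
      by (simp add: transpose_diff transpose_scalar) (simp add: V_def transpose_def vec_eq_iff mult.commute)
    show "\<forall>y. 0 \<le> qf ((x \<bullet> x) *\<^sub>R mat 1 - V) y"
      using Cauchy_Schwarz_ineq[of x] by (simp add: qf_def V inner_simps algebra_simps scaleR_mult_vec inner_commute power2_eq_square)
  qed
  from trace_mult_psd_nonneg[OF assms this]
  have "trace (M ** V) \<le> trace M * (x \<bullet> x)"
    by (simp add: matrix_diff_ldistrib trace_sub matrix_scalar_ac trace_scaleR mult.commute)
  also have "trace (M ** V) = qf M x"
    by (simp add: trace_def matrix_matrix_mult_def V_def qf_def matrix_vector_mult_def inner_vec_def sum_distrib_left mult_ac)
  finally show ?thesis .
qed

lemma psd_trace_zero:
  assumes "psd M" "trace M \<le> 0" shows "M = 0"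
proof (rule sym_matrix_eqI)
  show "qf M x = qf 0 x" for x
    using qf_le_trace[OF assms(1), of x] psd_nonneg[OF assms(1), of x] assms(2)
      mult_nonpos_nonneg[of "trace M" "x \<bullet> x"] by simp
qed (use assms psd_sym transpose_zero in auto)

section \<open>Periodic Lyapunov equations\<close>

text \<open>If \<open>S\<close> is a supersolution of the forward Lyapunov equation driven by \<open>mat 1\<close>,
  then the backward equation \<open>P k = C k + congr (M k) (P (\<sigma> k))\<close> is solvable, and the least solution
  costs no more than \<open>S\<close> does. The solution is the limit of the iteration from zero. What bounds the
  iteration is the trace pairing with \<open>S\<close>: one step of the backward iteration, paired with \<open>S\<close>, pays for the trace of the previous iterate.

  The time step is an arbitrary bijection \<open>\<sigma>\<close> of a finite index set, so that the same statement, read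
  with \<open>\<sigma>\<close> inverted and \<open>M\<close> transposed, also solves the forward equation.\<close>

lemma lyapunov_duality_bij:
  fixes M C S :: "'i \<Rightarrow> real^'n^'n"
  assumes I: "finite I" "bij_betw \<sigma> I I"
    and C: "\<And>k. k \<in> I \<Longrightarrow> psd (C k)" and S: "\<And>k. k \<in> I \<Longrightarrow> psd (S k)"
    and SM: "\<And>k. k \<in> I \<Longrightarrow> loewner_ge (S (\<sigma> k)) (mat 1 + congr (transpose (M k)) (S k))"
  shows "\<exists>P. (\<forall>k\<in>I. psd (P k)) \<and> (\<forall>k\<in>I. P k = C k + congr (M k) (P (\<sigma> k))) \<and>
    (\<Sum>k\<in>I. trace (P k)) \<le> (\<Sum>k\<in>I. trace (C k ** S k)) \<and>
    (\<forall>W. (\<forall>k\<in>I. psd (W k) \<and> loewner_ge (W k) (C k + congr (M k) (W (\<sigma> k)))) \<longrightarrow>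
       (\<forall>k\<in>I. loewner_ge (W k) (P k)))"
proof -
  have \<sigma>: "\<sigma> k \<in> I" if "k \<in> I" for k using I(2) that by (auto simp: bij_betw_def)
  define F where "F = (\<lambda>P k. C k + congr (M k) (P (\<sigma> k)))"
  \<comment> \<open>the iterates of the right-hand side of the backward equation, started at zero\<close>
  define T where "T = (\<lambda>N. (F ^^ N) (\<lambda>_. 0))"
  have T0: "T 0 k = 0" and TS: "T (Suc N) k = C k + congr (M k) (T N (\<sigma> k))" for N k
    by (simp_all add: T_def F_def)
  have Tpsd: "psd (T N k)" if "k \<in> I" for N k
    using that by (induction N arbitrary: k) (auto simp: T0 TS psd_zero psd_add psd_congr C \<sigma>)
  have Tinc: "loewner_ge (T (Suc N) k) (T N k)" if "k \<in> I" for N k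
    using that
  proof (induction N arbitrary: k)
    case 0
    then show ?case by (simp add: T0 TS loewner_ge_def psd_add psd_congr psd_zero C \<sigma>)
  next
    case (Suc N)
    have "qf (T (Suc N) k) x \<le> qf (T (Suc (Suc N)) k) x" for x
      using loewner_geD[OF Suc.IH[OF \<sigma>[OF Suc.prems]]] by (simp add: TS[of "Suc N"] TS[of N k])
    then show ?case
      using Suc.prems by (simp add: loewner_ge_iff psd_sym Tpsd)
  qed
  have Ttrace: "(\<Sum>k\<in>I. trace (T N k)) \<le> (\<Sum>k\<in>I. trace (C k ** S k))" for N
  proof -
    have step: "trace (T N (\<sigma> k)) + trace (T (Suc N) k ** S k) - trace (T N (\<sigma> k) ** S (\<sigma> k)) \<le> trace (C k ** S k)"
      if k: "k \<in> I" for k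
    proof -
      have "trace (T N (\<sigma> k) ** (mat 1 + congr (transpose (M k)) (S k))) \<le> trace (T N (\<sigma> k) ** S (\<sigma> k))"
        by (intro trace_mult_mono_right Tpsd \<sigma> SM k)
      then have "trace (T N (\<sigma> k)) + trace (congr (M k) (T N (\<sigma> k)) ** S k) \<le> trace (T N (\<sigma> k) ** S (\<sigma> k))"
        by (simp add: trace_congr trace_add matrix_add_ldistrib)
      then show ?thesis
        by (simp add: TS trace_add matrix_add_rdistrib)
    qed
    have re: "(\<Sum>k\<in>I. f (\<sigma> k)) = (\<Sum>k\<in>I. f k)" for f :: "'i \<Rightarrow> real"
      by (rule sum.reindex_bij_betw[OF I(2)])
    have "(\<Sum>k\<in>I. trace (T N k ** S k)) \<le> (\<Sum>k\<in>I. trace (T (Suc N) k ** S k))"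
      by (intro sum_mono trace_mult_mono_left S Tinc)
    moreover have "(\<Sum>k\<in>I. trace (T N (\<sigma> k)) + trace (T (Suc N) k ** S k) - trace (T N (\<sigma> k) ** S (\<sigma> k)))
       \<le> (\<Sum>k\<in>I. trace (C k ** S k))"
      by (intro sum_mono step)
    ultimately show ?thesis
      using re[of "\<lambda>k. trace (T N k)"] re[of "\<lambda>k. trace (T N k ** S k)"]
      by (simp add: sum.distrib sum_subtractf)
  qed
  have "\<exists>L. (\<lambda>N. T N k) \<longlonglongrightarrow> L" if k: "k \<in> I" for k
  proof (rule psd_increasing_converges)
    fix x
    have "qf (T N k) x \<le> (\<Sum>k\<in>I. trace (C k ** S k)) * (x \<bullet> x)" for N
    proof -
      have "trace (T N k) \<le> (\<Sum>k\<in>I. trace (T N k))"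
        using k I by (intro member_le_sum trace_psd_nonneg Tpsd) auto
      then have "trace (T N k) * (x \<bullet> x) \<le> (\<Sum>k\<in>I. trace (C k ** S k)) * (x \<bullet> x)"
        using Ttrace[of N] by (intro mult_right_mono) auto
      then show ?thesis using qf_le_trace[OF Tpsd[OF k], of N x] by linarith
    qed
    then show "\<exists>b. \<forall>N. qf (T N k) x \<le> b" by blast
  qed (use k Tinc psd_sym[OF Tpsd] in auto)
  then obtain P where P: "\<And>k. k \<in> I \<Longrightarrow> (\<lambda>N. T N k) \<longlonglongrightarrow> P k" by metis
  have Ppsd: "psd (P k)" if "k \<in> I" for k
    using psd_limit[OF P[OF that]] Tpsd that by blast
  show ?thesis
  proof (intro exI conjI ballI allI impI)
    show "psd (P k)" if "k \<in> I" for k by (rule Ppsd[OF that])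
    show "P k = C k + congr (M k) (P (\<sigma> k))" if "k \<in> I" for k
    proof (rule LIMSEQ_unique)
      show "(\<lambda>N. T (Suc N) k) \<longlonglongrightarrow> P k" using P[OF that] by (rule LIMSEQ_Suc)
      show "(\<lambda>N. T (Suc N) k) \<longlonglongrightarrow> C k + congr (M k) (P (\<sigma> k))"
        unfolding TS by (intro tendsto_intros tendsto_congr P \<sigma> that)
    qed
    show "(\<Sum>k\<in>I. trace (P k)) \<le> (\<Sum>k\<in>I. trace (C k ** S k))"
    proof (rule LIMSEQ_le_const2)
      show "(\<lambda>N. \<Sum>k\<in>I. trace (T N k)) \<longlonglongrightarrow> (\<Sum>k\<in>I. trace (P k))"
        unfolding trace_def by (intro tendsto_intros P)
    qed (use Ttrace in blast)
    show "loewner_ge (W k) (P k)"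
      if W: "\<forall>k\<in>I. psd (W k) \<and> loewner_ge (W k) (C k + congr (M k) (W (\<sigma> k)))" and k: "k \<in> I" for W k
    proof -
      have "qf (T N k) x \<le> qf (W k) x" for N x
        using k
      proof (induction N arbitrary: k x)
        case (Suc N)
        show ?case
          using Suc.IH[OF \<sigma>[OF Suc.prems], of "M k *v x"] W Suc.prems
            loewner_geD[of "W k" "C k + congr (M k) (W (\<sigma> k))" x]
          by (simp add: TS)
      qed (use W in \<open>simp add: T0 psd_nonneg\<close>)
      then have "qf (P k) x \<le> qf (W k) x" for x
        using LIMSEQ_le_const2[OF tendsto_qf[OF P[OF k] tendsto_const]] by blast
      then show ?thesis using W Ppsd k by (simp add: loewner_ge_iff psd_sym)
    qed
  qed
qed

definition periodic :: "nat \<Rightarrow> (nat \<Rightarrow> 'a) \<Rightarrow> bool" where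
  "periodic \<phi> f \<longleftrightarrow> (\<forall>k. f (k + \<phi>) = f k)"

lemma periodic_mult:
  assumes "periodic \<phi> f" shows "f (k + p * \<phi>) = f k"
proof (induction p)
  case (Suc p)
  have "f (k + Suc p * \<phi>) = f ((k + p * \<phi>) + \<phi>)" by (simp add: algebra_simps)
  then show ?case using assms Suc by (simp add: periodic_def)
qed simp

lemma periodic_mod:
  assumes "periodic \<phi> f" shows "f (k mod \<phi>) = f k"
  using periodic_mult[OF assms, of "k mod \<phi>" "k div \<phi>"] by simp

lemma periodic_of_mod: "periodic \<phi> (\<lambda>k. f (k mod \<phi>))"
  by (simp add: periodic_def)

lemma periodic_eqI:
  assumes "periodic \<phi> f" "periodic \<phi> g" "\<phi> \<ge> 1" "\<And>k. k < \<phi> \<Longrightarrow> f k = g k"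
  shows "f k = g k"
  by (metis assms mod_less_divisor periodic_mod less_le_trans zero_less_one)

text \<open>Cyclic successor and cyclic predecessor are mutually inverse; the predecessor is written
  as adding \<open>\<phi> - 1\<close> to avoid truncated subtraction at \<open>0\<close>.\<close>

lemma mod_shift_inverse:
  fixes \<phi> :: nat
  assumes "\<phi> \<ge> 1"
  shows "(Suc a mod \<phi> + (\<phi> - 1)) mod \<phi> = a mod \<phi>" "Suc ((a + (\<phi> - 1)) mod \<phi>) mod \<phi> = a mod \<phi>"
proof -
  have "Suc a + (\<phi> - 1) = a + \<phi>" using assms by simp
  then show "(Suc a mod \<phi> + (\<phi> - 1)) mod \<phi> = a mod \<phi>" "Suc ((a + (\<phi> - 1)) mod \<phi>) mod \<phi> = a mod \<phi>"
    by (metis mod_add_left_eq mod_add_self2, metis add_Suc mod_Suc_eq mod_add_self2)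
qed

lemma bij_betw_mod_shift:
  fixes \<phi> :: nat
  assumes "\<phi> \<ge> 1"
  shows "bij_betw (\<lambda>k. Suc k mod \<phi>) {..<\<phi>} {..<\<phi>}"
    "bij_betw (\<lambda>k. (k + (\<phi> - 1)) mod \<phi>) {..<\<phi>} {..<\<phi>}"
proof -
  have *: "\<forall>a\<in>{..<\<phi>}. (Suc a mod \<phi> + (\<phi> - 1)) mod \<phi> = a"
    "\<forall>a\<in>{..<\<phi>}. Suc ((a + (\<phi> - 1)) mod \<phi>) mod \<phi> = a"
    unfolding mod_shift_inverse[OF assms] by auto
  have **: "(\<lambda>k. Suc k mod \<phi>) ` {..<\<phi>} \<subseteq> {..<\<phi>}" "(\<lambda>k. (k + (\<phi> - 1)) mod \<phi>) ` {..<\<phi>} \<subseteq> {..<\<phi>}"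
    using assms by auto
  show "bij_betw (\<lambda>k. Suc k mod \<phi>) {..<\<phi>} {..<\<phi>}"
    by (rule bij_betw_byWitness[OF * **])
  show "bij_betw (\<lambda>k. (k + (\<phi> - 1)) mod \<phi>) {..<\<phi>} {..<\<phi>}"
    by (rule bij_betw_byWitness[OF *(2,1) **(2,1)])
qed

lemma sum_periodic_shift:
  fixes f :: "nat \<Rightarrow> real"
  assumes "periodic \<phi> f"
  shows "(\<Sum>k<\<phi>. f (Suc k)) = (\<Sum>k<\<phi>. f k)"
proof -
  have "f \<phi> = f 0" using assms by (metis add_0 periodic_def)
  then show ?thesis
    using sum.lessThan_Suc_shift[of f \<phi>] sum.lessThan_Suc[of f \<phi>] by simp
qed

lemma lyapunov_duality:
  fixes M C S :: "nat \<Rightarrow> real^'n^'n"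
  assumes \<phi>: "\<phi> \<ge> 1" and per: "periodic \<phi> M" "periodic \<phi> C" "periodic \<phi> S"
    and C: "\<And>k. psd (C k)" and S: "\<And>k. psd (S k)"
    and SM: "\<And>k. loewner_ge (S (Suc k)) (mat 1 + congr (transpose (M k)) (S k))"
  shows "\<exists>P. periodic \<phi> P \<and> (\<forall>k. psd (P k)) \<and> (\<forall>k. P k = C k + congr (M k) (P (Suc k))) \<and>
    (\<Sum>k<\<phi>. trace (P k)) \<le> (\<Sum>k<\<phi>. trace (C k ** S k)) \<and>
    (\<forall>W. periodic \<phi> W \<longrightarrow> (\<forall>k. psd (W k) \<and> loewner_ge (W k) (C k + congr (M k) (W (Suc k)))) \<longrightarrow>
       (\<forall>k. loewner_ge (W k) (P k)))"
proof -
  have "loewner_ge (S (Suc k mod \<phi>)) (mat 1 + congr (transpose (M k)) (S k))" for k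
    using SM[of k] by (simp add: periodic_mod[OF per(3)])
  from lyapunov_duality_bij[where I = "{..<\<phi>}" and C = C and S = S and M = M,
      OF finite_lessThan bij_betw_mod_shift(1)[OF \<phi>] C S this]
  obtain P where P: "\<forall>k<\<phi>. psd (P k)" "\<forall>k<\<phi>. P k = C k + congr (M k) (P (Suc k mod \<phi>))"
    "(\<Sum>k<\<phi>. trace (P k)) \<le> (\<Sum>k<\<phi>. trace (C k ** S k))"
    "\<forall>W. (\<forall>k<\<phi>. psd (W k) \<and> loewner_ge (W k) (C k + congr (M k) (W (Suc k mod \<phi>)))) \<longrightarrow>
       (\<forall>k<\<phi>. loewner_ge (W k) (P k))"
    unfolding Ball_def lessThan_iff by blast
  have lt: "k mod \<phi> < \<phi>" for k using \<phi> by auto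
  show ?thesis
  proof (intro exI conjI allI impI)
    show "periodic \<phi> (\<lambda>k. P (k mod \<phi>))" by (rule periodic_of_mod)
    show "psd (P (k mod \<phi>))" for k using P(1) lt by blast
    show "P (k mod \<phi>) = C k + congr (M k) (P (Suc k mod \<phi>))" for k
    proof -
      have "P (k mod \<phi>) = C (k mod \<phi>) + congr (M (k mod \<phi>)) (P (Suc (k mod \<phi>) mod \<phi>))"
        by (rule P(2)[rule_format, OF lt])
      then show ?thesis by (simp only: mod_Suc_eq periodic_mod[OF per(1)] periodic_mod[OF per(2)])
    qed
    show "(\<Sum>k<\<phi>. trace (P (k mod \<phi>))) \<le> (\<Sum>k<\<phi>. trace (C k ** S k))" using P(3) by simp
    show "loewner_ge (W k) (P (k mod \<phi>))"
      if W: "periodic \<phi> W" "\<forall>k. psd (W k) \<and> loewner_ge (W k) (C k + congr (M k) (W (Suc k)))" for W k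
    proof -
      have "psd (W k) \<and> loewner_ge (W k) (C k + congr (M k) (W (Suc k mod \<phi>)))" for k
        using W(2) by (simp only: periodic_mod[OF W(1)])
      then have "loewner_ge (W (k mod \<phi>)) (P (k mod \<phi>))" using P(4) lt by blast
      then show ?thesis by (simp only: periodic_mod[OF W(1)])
    qed
  qed
qed

text \<open>For periodic \<open>M\<close> this certificate is equivalent to \<open>x (Suc k) = M k *v x k\<close>
  driving every initial state to zero; see \<open>lyapunov_stable_tendsto_zero\<close> and
  \<open>lyapunov_stable_if_tendsto_zero\<close>.\<close>

definition lyapunov_stable :: "nat \<Rightarrow> (nat \<Rightarrow> real^'n^'n) \<Rightarrow> bool" where
  "lyapunov_stable \<phi> M \<longleftrightarrow> (\<exists>W. periodic \<phi> W \<and> (\<forall>k. psd (W k)) \<and>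
     (\<forall>k. loewner_ge (W k) (mat 1 + congr (M k) (W (Suc k)))))"

lemma lyapunov_stable_of_dual:
  assumes \<phi>: "\<phi> \<ge> 1" and per: "periodic \<phi> M" "periodic \<phi> S"
    and S: "\<And>k. psd (S k)"
    and SM: "\<And>k. loewner_ge (S (Suc k)) (mat 1 + congr (transpose (M k)) (S k))"
  shows "lyapunov_stable \<phi> M"
proof -
  have "periodic \<phi> (\<lambda>_. mat 1)" by (simp add: periodic_def)
  from lyapunov_duality[OF \<phi> per(1) this per(2) psd_mat1 S SM]
  obtain P where P: "periodic \<phi> P" "\<And>k. psd (P k)" "\<And>k. P k = mat 1 + congr (M k) (P (Suc k))" by blast
  have "loewner_ge (P k) (mat 1 + congr (M k) (P (Suc k)))" for k
    by (simp add: P(3)[of k, symmetric] loewner_ge_def psd_zero)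
  with P show ?thesis unfolding lyapunov_stable_def by blast
qed

text \<open>This is \<open>lyapunov_duality_bij\<close> in reversed time: \<open>\<tau>\<close> is the cyclic predecessor,
  and the certificate \<open>W\<close> plays the part of the supersolution.\<close>

lemma lyapunov_stable_gramian:
  fixes M :: "nat \<Rightarrow> real^'n^'n"
  assumes \<phi>: "\<phi> \<ge> 1" and per: "periodic \<phi> M" and st: "lyapunov_stable \<phi> M"
  shows "\<exists>S. periodic \<phi> S \<and> (\<forall>k. psd (S k)) \<and> (\<forall>k. loewner_ge (S k) (mat 1)) \<and>
    (\<forall>k. S (Suc k) = mat 1 + congr (transpose (M k)) (S k))"
proof -
  obtain W where W: "periodic \<phi> W" "\<And>k. psd (W k)"
    "\<And>k. loewner_ge (W k) (mat 1 + congr (M k) (W (Suc k)))"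
    using st unfolding lyapunov_stable_def by blast
  define \<tau> where "\<tau> k = (k + (\<phi> - 1)) mod \<phi>" for k
  have \<tau>: "Suc (\<tau> j) mod \<phi> = j mod \<phi>" for j unfolding \<tau>_def by (rule mod_shift_inverse(2)[OF \<phi>])
  have \<tau>': "\<tau> (Suc k mod \<phi>) = k mod \<phi>" for k unfolding \<tau>_def by (rule mod_shift_inverse(1)[OF \<phi>])
  have bij: "bij_betw \<tau> {..<\<phi>} {..<\<phi>}" unfolding \<tau>_def by (rule bij_betw_mod_shift(2)[OF \<phi>])
  have ge: "loewner_ge (W (\<tau> j)) (mat 1 + congr (transpose (transpose (M (\<tau> j)))) (W j))" for j
    using W(3)[of "\<tau> j"] \<tau>[of j] periodic_mod[OF W(1)] by (metis transpose_transpose)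
  obtain P where P: "\<forall>k<\<phi>. psd (P k)"
    "\<forall>k<\<phi>. P k = mat 1 + congr (transpose (M (\<tau> k))) (P (\<tau> k))"
    using lyapunov_duality_bij[where I = "{..<\<phi>}" and C = "\<lambda>_. mat 1" and S = W and M = "\<lambda>k. transpose (M (\<tau> k))",
      OF finite_lessThan bij psd_mat1 W(2) ge] unfolding Ball_def lessThan_iff by blast
  have lt: "k mod \<phi> < \<phi>" for k using \<phi> by auto
  define S where "S k = P (k mod \<phi>)" for k
  have S: "periodic \<phi> S" "\<And>k. psd (S k)"
    using P(1) lt by (simp_all add: S_def periodic_def)
  have SS: "S (Suc k) = mat 1 + congr (transpose (M k)) (S k)" for k
    using P(2) lt[of "Suc k"] \<tau>'[of k] periodic_mod[OF per, of k] by (simp add: S_def)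
  moreover have "loewner_ge (S k) (mat 1)" for k
  proof -
    have "S k = S (Suc (k + \<phi> - 1))" using S(1) \<phi> by (simp add: periodic_def)
    then show ?thesis using SS[of "k + \<phi> - 1"] S(2) by (simp add: loewner_ge_def psd_congr)
  qed
  ultimately show ?thesis using S by blast
qed

lemma decrease_imp_tendsto_zero:
  fixes x :: "nat \<Rightarrow> real^'n" and v :: "nat \<Rightarrow> real"
  assumes v: "\<And>k. 0 \<le> v k" "\<And>k. c * (x k \<bullet> x k) + v (Suc k) \<le> v k" and c: "c > 0"
  shows "x \<longlonglongrightarrow> 0"
proof -
  have le: "(\<Sum>k<N. x k \<bullet> x k) \<le> v 0 / c" for N
  proof -
    have "c * (\<Sum>k<N. x k \<bullet> x k) + v N \<le> v 0"
    proof (induction N)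
      case (Suc N) then show ?case using v(2)[of N] by (simp add: distrib_left)
    qed simp
    then show ?thesis using c v(1)[of N] by (simp add: field_simps)
  qed
  have "summable (\<lambda>k. x k \<bullet> x k)"
    by (rule bounded_imp_summable[where B = "v 0 / c"])
      (use le in \<open>simp_all only: lessThan_Suc_atMost[symmetric] inner_ge_zero\<close>)
  then have "(\<lambda>k. x k \<bullet> x k) \<longlonglongrightarrow> 0" by (rule summable_LIMSEQ_zero)
  then have "(\<lambda>k. sqrt (x k \<bullet> x k)) \<longlonglongrightarrow> sqrt 0" by (rule tendsto_real_sqrt)
  then show ?thesis by (simp add: norm_eq_sqrt_inner[symmetric] tendsto_norm_zero_iff)
qed

lemma lyapunov_stable_tendsto_zero:
  assumes st: "lyapunov_stable \<phi> M" and x: "\<And>k. x (Suc k) = M k *v x k"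
  shows "x \<longlonglongrightarrow> 0"
proof -
  obtain W where W: "\<And>k. psd (W k)" "\<And>k. loewner_ge (W k) (mat 1 + congr (M k) (W (Suc k)))"
    using st unfolding lyapunov_stable_def by blast
  show ?thesis
  proof (rule decrease_imp_tendsto_zero)
    show "0 \<le> qf (W k) (x k)" for k by (rule psd_nonneg[OF W(1)])
    show "1 * (x k \<bullet> x k) + qf (W (Suc k)) (x (Suc k)) \<le> qf (W k) (x k)" for k
      using loewner_geD[OF W(2), of k "x k"] by (simp add: x)
  qed simp
qed

text \<open>Both sides compute the cost of the steady-state covariance, once through \<open>S\<close>
  and once through the cost matrices \<open>P\<close>. The terms \<open>trace (P k ** S k)\<close> telescope over a period. The
  defects \<open>D\<close> and \<open>E\<close> of the two Lyapunov equations enter with opposite signs, which is why a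
  subsolution \<open>P\<close> bounds the cost from below and an improvable \<open>P\<close> certifies a cheaper covariance.\<close>

lemma lyapunov_trace_identity:
  fixes M C D E P S :: "nat \<Rightarrow> real^'n^'n"
  assumes P: "periodic \<phi> P" and S: "periodic \<phi> S"
    and PD: "\<And>k. P k = C k + congr (M k) (P (Suc k)) + D k"
    and SE: "\<And>k. S (Suc k) = mat 1 + congr (transpose (M k)) (S k) + E k"
  shows "(\<Sum>k<\<phi>. trace (C k ** S k)) =
    (\<Sum>k<\<phi>. trace (P k)) + (\<Sum>k<\<phi>. trace (P (Suc k) ** E k)) - (\<Sum>k<\<phi>. trace (D k ** S k))"
proof -
  have "trace (C k ** S k) = trace (P k ** S k) - trace (P (Suc k) ** S (Suc k))
      + trace (P (Suc k)) + trace (P (Suc k) ** E k) - trace (D k ** S k)" for k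
  proof -
    have "trace (P k ** S k) = trace ((C k + congr (M k) (P (Suc k)) + D k) ** S k)"
      by (subst PD) (rule refl)
    then show ?thesis
      by (simp add: SE trace_add matrix_add_rdistrib matrix_add_ldistrib trace_congr)
  qed
  moreover have "(\<Sum>k<\<phi>. trace (P (Suc k) ** S (Suc k))) = (\<Sum>k<\<phi>. trace (P k ** S k))"
    using P S by (intro sum_periodic_shift) (simp add: periodic_def)
  moreover have "(\<Sum>k<\<phi>. trace (P (Suc k))) = (\<Sum>k<\<phi>. trace (P k))"
    using P by (intro sum_periodic_shift) (simp add: periodic_def)
  ultimately show ?thesis by (simp add: sum.distrib sum_subtractf)
qed

section \<open>Block matrices and Schur complements\<close>

definition vjoin :: "real^'a \<Rightarrow> real^'b \<Rightarrow> real^('a + 'b)" where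
  "vjoin y z = (\<chi> i. case i of Inl a \<Rightarrow> y $ a | Inr b \<Rightarrow> z $ b)"

lemma vjoin_exhaust: obtains y z where "v = vjoin y z"
proof
  show "v = vjoin (\<chi> a. v $ Inl a) (\<chi> b. v $ Inr b)"
    by (simp add: vjoin_def vec_eq_iff split: sum.split)
qed

lemma sum_UNIV_sum_type:
  "(\<Sum>i\<in>UNIV. f i) = (\<Sum>a\<in>UNIV. f (Inl (a::'a::finite))) + (\<Sum>b\<in>UNIV. f (Inr (b::'b::finite)))"
  unfolding UNIV_Plus_UNIV[symmetric] by (subst sum.Plus) (auto simp: o_def)

lemma qf_block22:
  "qf (block22 M11 M12 M21 M22) (vjoin y z) =
    y \<bullet> (M11 *v y) + y \<bullet> (M12 *v z) + z \<bullet> (M21 *v y) + z \<bullet> (M22 *v z)"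
  unfolding qf_def block22_def vjoin_def inner_vec_def matrix_vector_mult_def
  by (simp add: sum_UNIV_sum_type distrib_left sum.distrib)

lemma transpose_block22:
  "transpose (block22 M11 M12 M21 M22) =
    block22 (transpose M11) (transpose M21) (transpose M12) (transpose M22)"
  unfolding transpose_def block22_def by (auto simp: vec_eq_iff split: sum.split)

text \<open>As the off-diagonal block factors through \<open>S\<close>,
  completing the square gives the form of the block matrix at \<open>(y, z)\<close> as that of
  \<open>W - congr (transpose M) S\<close> at \<open>y\<close> plus that of \<open>S\<close> at \<open>transpose M *v y + z\<close>.\<close>

lemma psd_block22_iff:
  fixes W :: "real^'a^'a" and S :: "real^'n^'n" and M :: "real^'n^'a"
  assumes W: "transpose W = W" and S: "psd S"
  shows "psd (block22 W (M ** S) (S ** transpose M) S) \<longleftrightarrow> loewner_ge W (congr (transpose M) S)"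
proof -
  have St: "transpose S = S" using S by (simp add: psd_iff)
  have sq: "qf (block22 W (M ** S) (S ** transpose M) S) (vjoin y z) =
      qf W y - qf (congr (transpose M) S) y + qf S (transpose M *v y + z)" for y z
  proof -
    have "y \<bullet> ((M ** S) *v z) = (transpose M *v y) \<bullet> (S *v z)"
      by (simp add: dot_lmul_matrix matrix_vector_mul_assoc del: dot_matrix_product)
    moreover have "z \<bullet> ((S ** transpose M) *v y) = (transpose M *v y) \<bullet> (S *v z)"
      using sym_form_commute[OF St, of z "transpose M *v y"] by (simp add: matrix_vector_mul_assoc[symmetric])
    ultimately show ?thesis
      by (simp only: qf_block22 qf_add[OF St] qf_congr) (simp add: qf_def)
  qed
  have t: "transpose (block22 W (M ** S) (S ** transpose M) S) = block22 W (M ** S) (S ** transpose M) S"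
    by (simp add: transpose_block22 matrix_transpose_mul St W)
  show ?thesis
  proof
    assume "psd (block22 W (M ** S) (S ** transpose M) S)"
    then have "0 \<le> qf W y - qf (congr (transpose M) S) y" for y
      using psd_nonneg[of _ "vjoin y (- (transpose M *v y))"] sq[of y "- (transpose M *v y)"] by fastforce
    then show "loewner_ge W (congr (transpose M) S)"
      by (simp add: loewner_ge_iff W St transpose_congr)
  next
    assume ge: "loewner_ge W (congr (transpose M) S)"
    have "0 \<le> qf (block22 W (M ** S) (S ** transpose M) S) v" for v
    proof -
      obtain y z where v: "v = vjoin y z" by (rule vjoin_exhaust)
      show ?thesis
        unfolding v sq using loewner_geD[OF ge, of y] psd_nonneg[OF S, of "transpose M *v y + z"] by linarith
    qed
    then show "psd (block22 W (M ** S) (S ** transpose M) S)" by (simp add: psd_iff t)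
  qed
qed

lemma psd_block22_diag:
  assumes "psd (block22 M11 M12 M21 M22)"
  shows "psd M11"
proof -
  have "0 \<le> qf M11 y" for y
    using psd_nonneg[OF assms, of "vjoin y 0"] unfolding qf_block22 by (simp add: qf_def)
  moreover have "transpose M11 = M11"
  proof -
    have "block22 M11 M12 M21 M22 $ Inl j $ Inl i = block22 M11 M12 M21 M22 $ Inl i $ Inl j" for i j
      using psd_sym[OF assms] by (metis (no_types, lifting) transpose_def vec_lambda_beta)
    then show ?thesis by (simp add: transpose_def vec_eq_iff block22_def)
  qed
  ultimately show ?thesis by (simp add: psd_iff)
qed

text \<open>With full row rank, the recorded data can be combined into any prescribed pair of a
  state block and an input block.\<close>

lemma vstack_full_rank_solve:
  fixes X :: "real^'l^'n" and U :: "real^'l^'m" and S :: "real^'p^'n" and V :: "real^'p^'m"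
  assumes "rank (vstack X U) = CARD('n) + CARD('m)"
  obtains H where "X ** H = S" "U ** H = V"
proof -
  have "rank (vstack X U) = CARD('n + 'm)" using assms by simp
  then obtain G where G: "vstack X U ** G = mat 1"
    using full_rank_surjective matrix_right_invertible_surjective by blast
  have eq: "vstack X U ** (G ** vstack S V) = vstack S V"
    by (simp add: matrix_mul_assoc G)
  have "(vstack X U ** H) $ Inl i = (X ** H) $ i" "(vstack X U ** H) $ Inr j = (U ** H) $ j" for H :: "real^'p^'l" and i j
    by (simp_all add: matrix_matrix_mult_def vstack_def vec_eq_iff)
  moreover have "vstack S V $ Inl i = S $ i" "vstack S V $ Inr j = V $ j" for i j
    by (simp_all add: vstack_def)
  ultimately have "X ** (G ** vstack S V) = S" "U ** (G ** vstack S V) = V"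
    using eq by (metis vec_eq_iff)+
  then show thesis by (rule that)
qed

section \<open>The semidefinite programme as a Lyapunov problem\<close>

definition closed_loop :: "(nat \<Rightarrow> real^'n^'n) \<Rightarrow> (nat \<Rightarrow> real^'m^'n) \<Rightarrow> (nat \<Rightarrow> real^'n^'m) \<Rightarrow> nat \<Rightarrow> real^'n^'n" where
  "closed_loop A B K k = A k + B k ** K k"

definition stage_weight :: "(nat \<Rightarrow> real^'n^'n) \<Rightarrow> (nat \<Rightarrow> real^'m^'m) \<Rightarrow> (nat \<Rightarrow> real^'n^'m) \<Rightarrow> nat \<Rightarrow> real^'n^'n" where
  "stage_weight Q R K k = Q k + congr (K k) (R k)"

lemma periodic_closed_loop:
  "periodic \<phi> A \<Longrightarrow> periodic \<phi> B \<Longrightarrow> periodic \<phi> K \<Longrightarrow> periodic \<phi> (closed_loop A B K)"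
  by (simp add: periodic_def closed_loop_def)

lemma periodic_stage_weight:
  "periodic \<phi> Q \<Longrightarrow> periodic \<phi> R \<Longrightarrow> periodic \<phi> K \<Longrightarrow> periodic \<phi> (stage_weight Q R K)"
  by (simp add: periodic_def stage_weight_def)

lemma psd_stage_weight: "psd (Q k) \<Longrightarrow> pd (R k) \<Longrightarrow> psd (stage_weight Q R K k)"
  by (simp add: stage_weight_def psd_add psd_congr pd_psd)

lemma columns_dynamics_imp_matrix_dynamics:
  fixes A :: "real^'n^'n" and B :: "real^'m^'n"
  assumes "\<And>j. column j X' = A *v column j X + B *v column j U"
  shows "X' = A ** X + B ** U"
proof -
  have "X' $ i $ j = (A ** X + B ** U) $ i $ j" for i j
    using arg_cong[OF assms[of j], of "\<lambda>v. v $ i"]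
    by (simp add: column_def matrix_vector_mult_def matrix_matrix_mult_def)
  then show ?thesis by (simp add: vec_eq_iff)
qed

text \<open>The data equation eliminates \<open>A\<close> and \<open>B\<close>: on matrices \<open>H\<close> whose state and
  input blocks are related by \<open>K\<close>, the measured successor states are those of the closed loop.\<close>

lemma data_times_H_eq_closed_loop:
  fixes A S :: "real^'n^'n" and B :: "real^'m^'n" and X :: "real^'l^'n" and U :: "real^'l^'m"
  assumes "X' = A ** X + B ** U" "S = X ** H" "K ** S = U ** H"
  shows "X' ** H = (A + B ** K) ** S"
  using assms by (simp add: matrix_add_rdistrib flip: matrix_mul_assoc)

text \<open>The second block constraint asks the control-cost variable to dominate the matrix on the
  left; at equality its trace is the control cost of the covariance \<open>S\<close>.\<close>

lemma control_weight_congr: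
  fixes R :: "real^'m^'m" and K :: "real^'n^'m"
  assumes "pd R"
  shows "trace (congr (transpose (psd_sqrt R ** K)) S) = trace (congr K R ** S)"
proof -
  have "congr (psd_sqrt R ** K) (mat 1) = transpose K ** (psd_sqrt R ** psd_sqrt R) ** K"
    by (simp add: congr_def matrix_transpose_mul psd_sym[OF psd_sqrt_of_pd(1)[OF assms]] matrix_mul_assoc)
  then have "congr (psd_sqrt R ** K) (mat 1) = congr K R"
    by (simp add: psd_sqrt_of_pd(2)[OF assms] congr_def)
  then show ?thesis
    using trace_congr[of "psd_sqrt R ** K" "mat 1" S] by simp
qed

text \<open>A feasible point encodes a gain \<open>K\<close> together with a supersolution \<open>S\<close> of
  its Lyapunov equation, by \<open>psd_block22_iff\<close> applied to both blocks, and its objective dominates the cost of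
  \<open>S\<close>. The diagonal block \<open>S (k + 1) - mat 1\<close> makes every \<open>S k\<close> invertible, hence \<open>K k ** S k = U k ** H k\<close>.\<close>

lemma sdp_feasible_imp_lyapunov:
  fixes A :: "nat \<Rightarrow> real^'n^'n" and B :: "nat \<Rightarrow> real^'m^'n"
    and X :: "nat \<Rightarrow> real^'l^'n" and U :: "nat \<Rightarrow> real^'l^'m"
  assumes feas: "sdp_feasible \<phi> X U R S H Y"
    and data_all: "\<forall>k<\<phi>. X (k + 1) = A k ** X k + B k ** U k"
    and R_all: "\<forall>k. pd (R k)"
    and K_all: "\<forall>k<\<phi>. K k = U k ** H k ** matrix_inv (S k)"
  shows "k \<le> \<phi> \<Longrightarrow> loewner_ge (S k) (mat 1)"
    and "k < \<phi> \<Longrightarrow> loewner_ge (S (Suc k)) (mat 1 + congr (transpose (closed_loop A B K k)) (S k))"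
    and "k < \<phi> \<Longrightarrow> trace (stage_weight Q R K k ** S k) \<le> trace (Q k ** S k) + trace (Y k)"
proof -
  note data = data_all[rule_format] and R = R_all[rule_format] and K = K_all[rule_format]
  have blocks: "psd (block22 (S (Suc k) - mat 1) (X (Suc k) ** H k)
                     (transpose (H k) ** transpose (X (Suc k))) (S k))"
      "psd (block22 (Y k) (psd_sqrt (R k) ** U k ** H k)
                     (transpose (H k) ** transpose (U k) ** psd_sqrt (R k)) (S k))"
      "S k = X k ** H k" "transpose (S (Suc k)) = S (Suc k)" "transpose (Y k) = Y k" if "k < \<phi>" for k
    using feas that by (auto simp: sdp_feasible_def)
  have ge1: "loewner_ge (S k) (mat 1)" if "k \<le> \<phi>" for k
  proof (cases k)
    case 0 then show ?thesis using feas by (simp add: sdp_feasible_def)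
  next
    case (Suc j) then show ?thesis using psd_block22_diag[OF blocks(1)[of j]] that by (simp add: loewner_ge_def)
  qed
  then show "k \<le> \<phi> \<Longrightarrow> loewner_ge (S k) (mat 1)" for k .
  have S: "psd (S k)" if "k < \<phi>" for k
    using ge1[of k] that loewner_ge_psd[OF psd_mat1] by simp
  have KS: "K k ** S k = U k ** H k" if "k < \<phi>" for k
  proof -
    have "pd (S k)" using ge1[of k] that by (simp add: pd_of_loewner_ge_mat1)
    then have "matrix_inv (S k) ** S k = mat 1" by (intro invertible_matrix_inv pd_invertible)
    then show ?thesis using that by (simp add: K flip: matrix_mul_assoc)
  qed
  show "loewner_ge (S (Suc k)) (mat 1 + congr (transpose (closed_loop A B K k)) (S k))" if k: "k < \<phi>" for k
  proof -
    have eq: "X (Suc k) ** H k = closed_loop A B K k ** S k"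
      unfolding closed_loop_def
      by (rule data_times_H_eq_closed_loop[OF _ blocks(3)[OF k] KS[OF k]]) (use data[OF k] in simp)
    have "transpose (H k) ** transpose (X (Suc k)) = S k ** transpose (closed_loop A B K k)"
      using arg_cong[OF eq, of transpose] by (simp add: matrix_transpose_mul psd_sym[OF S[OF k]])
    then have "loewner_ge (S (Suc k) - mat 1) (congr (transpose (closed_loop A B K k)) (S k))"
      using blocks(1)[OF k] S[OF k] blocks(4)[OF k] eq
      by (subst psd_block22_iff[symmetric]) (simp_all add: transpose_diff)
    then show ?thesis by (simp add: loewner_ge_def diff_diff_eq)
  qed
  show "trace (stage_weight Q R K k ** S k) \<le> trace (Q k ** S k) + trace (Y k)" if k: "k < \<phi>" for k
  proof -
    let ?N = "psd_sqrt (R k)"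
    have eq: "?N ** U k ** H k = (?N ** K k) ** S k"
      using KS[OF k] by (simp flip: matrix_mul_assoc)
    have "transpose (H k) ** transpose (U k) ** ?N = S k ** transpose (?N ** K k)"
      using arg_cong[OF eq, of transpose]
      by (simp add: matrix_transpose_mul matrix_mul_assoc psd_sym[OF S[OF k]] psd_sym[OF psd_sqrt_of_pd(1)[OF R]])
    then have "loewner_ge (Y k) (congr (transpose (?N ** K k)) (S k))"
      using blocks(2)[OF k] S[OF k] blocks(5)[OF k] eq
      by (subst psd_block22_iff[symmetric]) simp_all
    then have "trace (congr (transpose (?N ** K k)) (S k)) \<le> trace (Y k)"
      using trace_psd_nonneg by (fastforce simp: loewner_ge_def trace_sub)
    then show ?thesis
      by (simp add: control_weight_congr[OF R] stage_weight_def trace_add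
          matrix_add_rdistrib)
  qed
qed

text \<open>Converse of the encoding: the data realise any gain, and taking the control-cost
  variable equal to its lower bound leaves no gap in the objective.\<close>

lemma lyapunov_imp_sdp_feasible:
  fixes A :: "nat \<Rightarrow> real^'n^'n" and B :: "nat \<Rightarrow> real^'m^'n"
    and X :: "nat \<Rightarrow> real^'l^'n" and U :: "nat \<Rightarrow> real^'l^'m"
  assumes data_all: "\<forall>k<\<phi>. X (k + 1) = A k ** X k + B k ** U k"
    and rank_all: "\<forall>k<\<phi>. rank (vstack (X k) (U k)) = CARD('n) + CARD('m)"
    and R_all: "\<forall>k. pd (R k)"
    and S: "\<And>k. loewner_ge (S k) (mat 1)" "S \<phi> = S 0"
    and SM: "\<And>k. loewner_ge (S (Suc k)) (mat 1 + congr (transpose (closed_loop A B K k)) (S k))"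
  shows "\<exists>H Y. sdp_feasible \<phi> X U R S H Y \<and>
    sdp_objective \<phi> Q S Y = (\<Sum>k<\<phi>. trace (stage_weight Q R K k ** S k))"
proof -
  note data = data_all[rule_format] and rank = rank_all[rule_format] and R = R_all[rule_format]
  have Spsd: "psd (S k)" for k using S loewner_ge_psd[OF psd_mat1] by blast
  have "\<exists>H. X k ** H = S k \<and> U k ** H = K k ** S k" if "k < \<phi>" for k
    using vstack_full_rank_solve[OF rank[OF that], of "S k" "K k ** S k"] by blast
  then obtain H where H: "\<And>k. k < \<phi> \<Longrightarrow> X k ** H k = S k" "\<And>k. k < \<phi> \<Longrightarrow> U k ** H k = K k ** S k"
    by metis
  define Y where "Y k = congr (transpose (psd_sqrt (R k) ** K k)) (S k)" for k
  have "sdp_feasible \<phi> X U R S H Y"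
    unfolding sdp_feasible_def
  proof (intro conjI allI impI)
    show "transpose (S k) = S k" for k by (rule psd_sym[OF Spsd])
    show "transpose (Y k) = Y k" for k unfolding Y_def by (intro transpose_congr psd_sym[OF Spsd])
    show "loewner_ge (S 0) (mat 1)" "S \<phi> = S 0" by (fact S)+
    fix k assume k: "k < \<phi>"
    show "S k = X k ** H k" using H k by simp
    have eq: "X (k + 1) ** H k = closed_loop A B K k ** S k"
      unfolding closed_loop_def
      by (rule data_times_H_eq_closed_loop[OF data[OF k] H(1)[OF k, symmetric] H(2)[OF k, symmetric]])
    moreover have "transpose (H k) ** transpose (X (k + 1)) = S k ** transpose (closed_loop A B K k)"
      using arg_cong[OF eq, of transpose] by (simp add: matrix_transpose_mul psd_sym[OF Spsd])
    moreover have "loewner_ge (S (k + 1) - mat 1) (congr (transpose (closed_loop A B K k)) (S k))"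
      using SM[of k] by (simp add: loewner_ge_def diff_diff_eq)
    ultimately show "psd (block22 (S (k + 1) - mat 1) (X (k + 1) ** H k)
                     (transpose (H k) ** transpose (X (k + 1))) (S k))"
      using psd_block22_iff[of "S (k + 1) - mat 1" "S k" "closed_loop A B K k"] Spsd
      by (simp add: transpose_diff psd_sym[OF Spsd])
    have eq': "psd_sqrt (R k) ** U k ** H k = (psd_sqrt (R k) ** K k) ** S k"
      using H(2)[OF k] by (simp flip: matrix_mul_assoc)
    moreover have "transpose (H k) ** transpose (U k) ** psd_sqrt (R k) = S k ** transpose (psd_sqrt (R k) ** K k)"
      using arg_cong[OF eq', of transpose]
      by (simp add: matrix_transpose_mul matrix_mul_assoc psd_sym[OF Spsd] psd_sym[OF psd_sqrt_of_pd(1)[OF R]])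
    ultimately show "psd (block22 (Y k) (psd_sqrt (R k) ** U k ** H k)
                     (transpose (H k) ** transpose (U k) ** psd_sqrt (R k)) (S k))"
      using psd_block22_iff[of "Y k" "S k" "psd_sqrt (R k) ** K k"] Spsd
      by (simp add: Y_def transpose_congr psd_sym[OF Spsd] loewner_ge_def psd_zero)
  qed
  moreover have "sdp_objective \<phi> Q S Y = (\<Sum>k<\<phi>. trace (stage_weight Q R K k ** S k))"
    by (simp add: sdp_objective_def Y_def control_weight_congr[OF R] stage_weight_def trace_add
        matrix_add_rdistrib)
  ultimately show ?thesis by blast
qed

section \<open>The Bellman identity\<close>

definition lqr_gain :: "real^'n^'n \<Rightarrow> real^'m^'n \<Rightarrow> real^'m^'m \<Rightarrow> real^'n^'n \<Rightarrow> real^'n^'m" where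
  "lqr_gain A B R P = - (matrix_inv (R + congr B P) ** (transpose B ** P ** A))"

lemma lqr_gain_eq:
  assumes "pd R" "psd P"
  shows "(R + congr B P) ** lqr_gain A B R P = - (transpose B ** P ** A)"
proof -
  have "(R + congr B P) ** matrix_inv (R + congr B P) = mat 1"
    using assms by (intro invertible_matrix_inv pd_invertible pd_add_psd psd_congr)
  then show ?thesis
    unfolding lqr_gain_def
    by (simp add: bounded_bilinear.minus_right[OF bounded_bilinear_matrix_mult] matrix_mul_assoc)
qed

text \<open>Completing the square in the input. The defining equation \<open>lqr_gain_eq\<close> of the gain
  makes the cross term between \<open>K *v x\<close> and the deviation \<open>u - K *v x\<close> vanish.\<close>

lemma bellman_identity:
  fixes A :: "real^'n^'n" and B :: "real^'m^'n"
  assumes R: "pd R" and P: "psd P" and K: "K = lqr_gain A B R P"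
  shows "qf Q x + qf R u + qf P (A *v x + B *v u) =
    qf (Q + congr K R + congr (A + B ** K) P) x + qf (R + congr B P) (u - K *v x)"
proof -
  have Rt: "transpose R = R" and Pt: "transpose P = P" using R P by (simp_all add: pd_iff psd_iff)
  define w where "w = u - K *v x"
  have u: "u = K *v x + w" by (simp add: w_def)
  have next_eq: "A *v x + B *v u = (A + B ** K) *v x + B *v w"
    by (simp add: u algebra_simps matrix_vector_mul_assoc)
  have "(K *v x) \<bullet> (R *v w) + ((A + B ** K) *v x) \<bullet> (P *v (B *v w)) =
      w \<bullet> (R *v (K *v x)) + (B *v w) \<bullet> (P *v ((A + B ** K) *v x))"
    using sym_form_commute[OF Rt, of "K *v x" w] sym_form_commute[OF Pt, of "(A + B ** K) *v x" "B *v w"] by simp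
  also have "(B *v w) \<bullet> (P *v ((A + B ** K) *v x)) = w \<bullet> (transpose B *v (P *v ((A + B ** K) *v x)))"
    by (simp add: inner_commute[of "B *v w"] inner_commute[of w] dot_lmul_matrix)
  also have "w \<bullet> (R *v (K *v x)) + w \<bullet> (transpose B *v (P *v ((A + B ** K) *v x))) =
      w \<bullet> (((R + congr B P) ** K + transpose B ** P ** A) *v x)"
    by (simp add: congr_def matrix_vector_mul_assoc [symmetric] algebra_simps inner_simps del: transpose_matrix_vector)
  also have "\<dots> = 0" by (simp add: K lqr_gain_eq[OF R P])
  finally have cross: "(K *v x) \<bullet> (R *v w) + ((A + B ** K) *v x) \<bullet> (P *v (B *v w)) = 0" .
  show ?thesis
    unfolding next_eq w_def[symmetric]
    using cross by (simp add: u qf_add[OF Rt] qf_add[OF Pt])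
qed

text \<open>Periodicity turns bounds for each phase into one bound for all times.\<close>

lemma qf_uniform_bound:
  fixes f g :: "nat \<Rightarrow> 'x \<Rightarrow> real"
  assumes \<phi>: "\<phi> \<ge> 1" and per: "periodic \<phi> f" "periodic \<phi> g"
    and g: "\<And>k x. 0 \<le> g k x" and b: "\<And>k. \<exists>b. \<forall>x. f k x \<le> b * g k x"
  obtains b where "b > 0" "\<And>k x. f k x \<le> b * g k x"
proof -
  obtain c where c: "\<And>k x. f k x \<le> c k * g k x" using b by metis
  define b where "b = 1 + (\<Sum>k<\<phi>. \<bar>c k\<bar>)"
  have "f k x \<le> b * g k x" for k x
  proof -
    have lt: "k mod \<phi> < \<phi>" using \<phi> by simp
    have "c (k mod \<phi>) \<le> \<bar>c (k mod \<phi>)\<bar>" by simp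
    also have "\<dots> \<le> (\<Sum>k<\<phi>. \<bar>c k\<bar>)" using lt by (intro member_le_sum) auto
    finally have "c (k mod \<phi>) \<le> b" by (simp add: b_def)
    then have "c (k mod \<phi>) * g k x \<le> b * g k x" using g by (intro mult_right_mono) auto
    moreover have "f k x \<le> c (k mod \<phi>) * g k x"
      using c[of "k mod \<phi>" x] by (simp add: periodic_mod[OF per(1)] periodic_mod[OF per(2)])
    ultimately show ?thesis by linarith
  qed
  moreover have "b > 0" by (simp add: b_def add_pos_nonneg sum_nonneg)
  ultimately show thesis by (rule that[rotated])
qed

lemma qf_bounded_by_pd:
  fixes M R :: "real^'n^'n"
  assumes "pd R" shows "\<exists>b. \<forall>x. qf M x \<le> b * qf R x"
proof -
  obtain r where r: "r > 0" "\<And>x. r * (x \<bullet> x) \<le> qf R x" using pd_coercive[OF assms] by blast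
  obtain c where c: "c > 0" "\<And>x. \<bar>qf M x\<bar> \<le> c * (x \<bullet> x)" using qf_upper[of M] by blast
  have "qf M x \<le> c / r * qf R x" for x
  proof -
    have "qf M x \<le> c / r * (r * (x \<bullet> x))" using c(2)[of x] r by simp
    also have "\<dots> \<le> c / r * qf R x" using r c by (intro mult_left_mono) auto
    finally show ?thesis .
  qed
  then show ?thesis by blast
qed

text \<open>Young's inequality for a semidefinite form.\<close>

lemma qf_add_le:
  assumes "psd P" "e > 0"
  shows "qf P (a + b) \<le> (1 + e) * qf P a + (1 + 1 / e) * qf P b"
proof -
  have "qf P (s *\<^sub>R a + t *\<^sub>R b) = s\<^sup>2 * qf P a + 2 * (s * t) * (a \<bullet> (P *v b)) + t\<^sup>2 * qf P b" for s t
    unfolding qf_add[OF psd_sym[OF assms(1)]] by (simp add: matrix_vector_mult_scaleR)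
  from this[of "sqrt e" "- (1 / sqrt e)"]
  have "qf P (sqrt e *\<^sub>R a + (- (1 / sqrt e)) *\<^sub>R b) = e * qf P a - 2 * (a \<bullet> (P *v b)) + 1 / e * qf P b"
    using assms(2) by (simp add: power_divide)
  moreover have "0 \<le> qf P (sqrt e *\<^sub>R a + (- (1 / sqrt e)) *\<^sub>R b)" by (rule psd_nonneg[OF assms(1)])
  ultimately show ?thesis
    unfolding qf_add[OF psd_sym[OF assms(1)]] by (simp add: algebra_simps)
qed

definition riccati_policy ::
  "(nat \<Rightarrow> real^'n^'n) \<Rightarrow> (nat \<Rightarrow> real^'m^'n) \<Rightarrow> (nat \<Rightarrow> real^'m^'m) \<Rightarrow> (nat \<Rightarrow> real^'n^'n) \<Rightarrow> nat \<Rightarrow> real^'n^'m" where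
  "riccati_policy A B R P k = lqr_gain (A k) (B k) (R k) (P (Suc k))"

lemma periodic_riccati_policy:
  "periodic \<phi> A \<Longrightarrow> periodic \<phi> B \<Longrightarrow> periodic \<phi> R \<Longrightarrow> periodic \<phi> P \<Longrightarrow> periodic \<phi> (riccati_policy A B R P)"
  unfolding periodic_def riccati_policy_def by (metis add_Suc)

lemma bellman_step:
  assumes R: "pd (R k)" and P: "psd (P (Suc k))"
  shows "qf (Q k) x + qf (R k) u + qf (P (Suc k)) (A k *v x + B k *v u) =
    qf (stage_weight Q R (riccati_policy A B R P) k
        + congr (closed_loop A B (riccati_policy A B R P) k) (P (Suc k))) x
    + qf (R k + congr (B k) (P (Suc k))) (u - riccati_policy A B R P k *v x)"
  unfolding stage_weight_def closed_loop_def riccati_policy_def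
  by (rule bellman_identity[OF R P refl])

text \<open>The terminal cost vanishes along stabilising controls: a periodic family of forms
  is uniformly bounded.\<close>

lemma periodic_qf_tendsto_zero:
  fixes P :: "nat \<Rightarrow> real^'n^'n"
  assumes "\<phi> \<ge> 1" "periodic \<phi> P" "x \<longlonglongrightarrow> 0"
  shows "(\<lambda>k. qf (P k) (x k)) \<longlonglongrightarrow> 0"
proof -
  have "\<exists>b. \<forall>x. \<bar>qf (P k) x\<bar> \<le> b * (x \<bullet> x)" for k using qf_upper[of "P k"] by metis
  then obtain b where b: "\<And>k x. \<bar>qf (P k) x\<bar> \<le> b * (x \<bullet> x)"
    using qf_uniform_bound[where f = "\<lambda>k x. \<bar>qf (P k) x\<bar>" and g = "\<lambda>k x. x \<bullet> x" and \<phi> = \<phi>] assms(1,2)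
    unfolding periodic_def by (metis inner_ge_zero)
  have "(\<lambda>k. b * (x k \<bullet> x k)) \<longlonglongrightarrow> b * ((0::real^'n) \<bullet> 0)" using assms(3) by (intro tendsto_intros)
  then have lim: "(\<lambda>k. b * (x k \<bullet> x k)) \<longlonglongrightarrow> 0" by simp
  show ?thesis
    by (rule Lim_null_comparison[OF _ lim]) (use b in auto)
qed

section \<open>Trajectories and their cost\<close>

lemma lqr_cost_eq: "lqr_cost A B Q R x0 u =
   (\<Sum>k. ennreal (qf (Q k) (state_traj A B x0 u k) + qf (R k) (u k)))"
  by (simp add: lqr_cost_def qf_def)

lemma suminf_ennreal_le:
  assumes "\<And>k. 0 \<le> f k" "\<And>N. (\<Sum>k<N. f k) \<le> c"
  shows "(\<Sum>k. ennreal (f k)) \<le> ennreal c"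
  unfolding suminf_eq_SUP
  by (rule SUP_least) (simp add: assms sum_ennreal ennreal_leI)

lemma le_suminf_ennreal:
  assumes "\<And>k. 0 \<le> f k"
  shows "ennreal (\<Sum>k<N. f k) \<le> (\<Sum>k. ennreal (f k))"
proof -
  have "(\<Sum>k<N. ennreal (f k)) \<le> (\<Sum>k. ennreal (f k))" by (intro sum_le_suminf) auto
  then show ?thesis by (subst (asm) sum_ennreal) (auto simp: assms)
qed

lemma state_traj_feedback:
  obtains u where "\<And>k. u k = K k *v state_traj A B x0 u k"
    "\<And>k. state_traj A B x0 u (Suc k) = closed_loop A B K k *v state_traj A B x0 u k"
proof -
  define x where "x = rec_nat x0 (\<lambda>k y. closed_loop A B K k *v y)"
  define u where "u k = K k *v x k" for k
  have "state_traj A B x0 u k = x k" for k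
    by (induction k)
      (simp_all add: x_def u_def closed_loop_def matrix_vector_mult_add_rdistrib flip: matrix_vector_mul_assoc)
  then show thesis
    by (intro that[of u]) (simp_all only: u_def, simp add: x_def)
qed

text \<open>The gain solves a linear system whose matrix is bounded below by \<open>R\<close>, uniformly in the
  sequence. So the error \<open>Z\<close> is controlled by the residual \<open>E\<close> of the limit gain in the approximating
  systems.\<close>

lemma lqr_gain_tendsto:
  fixes A :: "real^'n^'n" and B :: "real^'m^'n"
  assumes R: "pd R" and lim: "P \<longlonglongrightarrow> L" and P: "\<And>N. psd (P N)"
  shows "(\<lambda>N. lqr_gain A B R (P N)) \<longlonglongrightarrow> lqr_gain A B R L"
proof -
  have L: "psd L" by (rule psd_limit[OF lim P])
  obtain r where r: "r > 0" "\<And>x. r * (x \<bullet> x) \<le> qf R x" using pd_coercive[OF R] by blast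
  define Z where "Z N = lqr_gain A B R (P N) - lqr_gain A B R L" for N
  define E where "E N = - (transpose B ** P N ** A) - (R + congr B (P N)) ** lqr_gain A B R L" for N
  have GZ: "(R + congr B (P N)) ** Z N = E N" for N
    by (simp add: Z_def E_def matrix_diff_ldistrib lqr_gain_eq[OF R P])
  have "E \<longlonglongrightarrow> - (transpose B ** L ** A) - (R + congr B L) ** lqr_gain A B R L"
    unfolding E_def by (intro tendsto_intros tendsto_matrix_mult tendsto_congr lim)
  then have E: "E \<longlonglongrightarrow> 0" by (simp add: lqr_gain_eq[OF R L])
  have "(\<lambda>N. Z N *v x) \<longlonglongrightarrow> 0" for x
  proof (rule Lim_null_comparison)
    have "r * norm (Z N *v x) \<le> norm (E N *v x)" for N
    proof (cases "Z N *v x = 0")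
      case False
      have "r * (norm (Z N *v x) * norm (Z N *v x)) \<le> qf R (Z N *v x)"
        using r(2)[of "Z N *v x"] by (simp add: power2_norm_eq_inner[symmetric] power2_eq_square)
      also have "\<dots> \<le> qf (R + congr B (P N)) (Z N *v x)" by (simp add: psd_nonneg P)
      also have "\<dots> = (Z N *v x) \<bullet> (E N *v x)"
        unfolding qf_def by (simp add: matrix_vector_mul_assoc GZ del: qf_simps)
      also have "\<dots> \<le> norm (Z N *v x) * norm (E N *v x)" by (rule norm_cauchy_schwarz)
      finally have "norm (Z N *v x) * (r * norm (Z N *v x)) \<le> norm (Z N *v x) * norm (E N *v x)"
        by (simp add: mult_ac)
      then show ?thesis using False by simp
    qed simp
    then show "\<forall>\<^sub>F N in sequentially. norm (Z N *v x) \<le> norm (E N *v x) / r"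
      using r by (intro always_eventually allI) (simp add: pos_le_divide_eq mult.commute)
    have "(\<lambda>N. norm (E N *v x) / r) \<longlonglongrightarrow> norm ((0::real^'n^'m) *v x) / r"
      using r by (intro tendsto_intros tendsto_matrix_vector E) auto
    then show "(\<lambda>N. norm (E N *v x) / r) \<longlonglongrightarrow> 0"
      by (simp only: matrix_vector_mult_0 norm_zero div_0)
  qed
  then have "(\<lambda>N. (Z N *v axis j 1) $ i) \<longlonglongrightarrow> 0 $ i" for i j by (intro tendsto_vec_nth)
  then have "(\<lambda>N. Z N $ i $ j) \<longlonglongrightarrow> (0::real^'n^'m) $ i $ j" for i j
    by (simp add: matrix_vector_mult_basis column_def)
  then have "Z \<longlonglongrightarrow> 0" by (intro vec_tendstoI) auto
  then show ?thesis unfolding Z_def by (simp add: LIM_zero_iff)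
qed

section \<open>Riccati solutions and policy improvement\<close>

locale periodic_lqr =
  fixes \<phi> :: nat and A :: "nat \<Rightarrow> real^'n^'n" and B :: "nat \<Rightarrow> real^'m^'n"
    and Q :: "nat \<Rightarrow> real^'n^'n" and R :: "nat \<Rightarrow> real^'m^'m"
  assumes period_pos: "\<phi> \<ge> 1"
    and per_A: "periodic \<phi> A" and per_B: "periodic \<phi> B" and per_Q: "periodic \<phi> Q" and per_R: "periodic \<phi> R"
    and psd_Q: "psd (Q k)" and pd_R: "pd (R k)"
begin

abbreviation "acl \<equiv> closed_loop A B"
abbreviation "weight \<equiv> stage_weight Q R"
abbreviation "policy \<equiv> riccati_policy A B R"
abbreviation "traj \<equiv> state_traj A B"
abbreviation "cost \<equiv> lqr_cost A B Q R"

text \<open>The periodic matrices \<open>P k\<close> give the cost \<open>qf (P k) x\<close> of applying the gain \<open>K\<close> forever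
  from the state \<open>x\<close> at time \<open>k\<close>, at least when \<open>K\<close> stabilises.\<close>

definition cost_to_go :: "(nat \<Rightarrow> real^'n^'m) \<Rightarrow> (nat \<Rightarrow> real^'n^'n) \<Rightarrow> bool" where
  "cost_to_go K P \<longleftrightarrow> periodic \<phi> P \<and> (\<forall>k. psd (P k)) \<and>
     (\<forall>k. P k = weight K k + congr (acl K k) (P (Suc k)))"

text \<open>The periodic Riccati equation: \<open>P\<close> is the cost of its own greedy gain.\<close>

definition riccati_solution :: "(nat \<Rightarrow> real^'n^'n) \<Rightarrow> bool" where
  "riccati_solution P \<longleftrightarrow> cost_to_go (policy P) P"

lemma cost_to_goD:
  assumes "cost_to_go K P"
  shows "periodic \<phi> P" "psd (P k)" "P k = weight K k + congr (acl K k) (P (Suc k))"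
  using assms unfolding cost_to_go_def by blast+

lemma periodic_policy: "periodic \<phi> P \<Longrightarrow> periodic \<phi> (policy P)"
  by (rule periodic_riccati_policy[OF per_A per_B per_R])

lemma stage_cost_nonneg: "0 \<le> qf (Q k) x + qf (R k) u"
  by (simp add: psd_nonneg psd_Q pd_psd pd_R)

lemma psd_weight: "psd (weight K k)"
  using psd_stage_weight psd_Q pd_R by blast

lemma psd_input_hessian: "psd P \<Longrightarrow> psd (R k + congr (B k) P)"
  by (rule psd_add[OF pd_psd[OF pd_R] psd_congr])

lemma riccati_sum:
  assumes P: "riccati_solution P"
  shows "(\<Sum>i<N. qf (Q i) (traj x0 u i) + qf (R i) (u i)) =
    qf (P 0) x0 - qf (P N) (traj x0 u N)
    + (\<Sum>i<N. qf (R i + congr (B i) (P (Suc i))) (u i - policy P i *v traj x0 u i))"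
proof (induction N)
  case (Suc N)
  note P = cost_to_goD[OF P[unfolded riccati_solution_def]]
  have "qf (Q N) (traj x0 u N) + qf (R N) (u N) + qf (P (Suc N)) (traj x0 u (Suc N)) =
      qf (P N) (traj x0 u N) + qf (R N + congr (B N) (P (Suc N))) (u N - policy P N *v traj x0 u N)"
    unfolding state_traj.simps
      arg_cong[where f = "\<lambda>M. qf M (traj x0 u N)", OF P(3)[of N]]
    by (rule bellman_step[OF pd_R P(2)])
  then show ?case using Suc by (simp del: qf_simps state_traj.simps)
qed simp

text \<open>In \<open>riccati_sum\<close> the terminal term tends to zero because \<open>v\<close> stabilises. Keeping one
  of the nonnegative deviation terms, rather than dropping all of them, gives both optimality of the Riccati
  gain and uniqueness of the optimal control.\<close>

lemma riccati_lower_bound: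
  assumes P: "riccati_solution P" and st: "stabilising A B x0 v"
  shows "ennreal (qf (P 0) x0 + qf (R i) (v i - policy P i *v traj x0 v i)) \<le> cost x0 v"
proof -
  let ?x = "traj x0 v"
  let ?d = "\<lambda>j. qf (R j + congr (B j) (P (Suc j))) (v j - policy P j *v ?x j)"
  let ?e = "qf (R i) (v i - policy P i *v ?x i)"
  note PD = cost_to_goD[OF P[unfolded riccati_solution_def]]
  have "(\<lambda>N. qf (P N) (?x N)) \<longlonglongrightarrow> 0"
    using st by (intro periodic_qf_tendsto_zero[OF period_pos PD(1)]) (simp add: stabilising_def)
  then have lim: "(\<lambda>N. ennreal (qf (P 0) x0 + ?e - qf (P N) (?x N))) \<longlonglongrightarrow> ennreal (qf (P 0) x0 + ?e - 0)"
    by (intro tendsto_intros tendsto_ennrealI)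
  have nn: "0 \<le> ?d j" for j by (intro psd_nonneg psd_input_hessian PD)
  have "ennreal (qf (P 0) x0 + ?e - qf (P N) (?x N)) \<le> cost x0 v" if N: "N \<ge> Suc i" for N
  proof -
    have "?e \<le> ?d i" by (simp add: psd_nonneg PD(2))
    also have "\<dots> \<le> (\<Sum>j<N. ?d j)"
      using N by (intro member_le_sum[of i "{..<N}" ?d] nn) auto
    finally have "qf (P 0) x0 + ?e - qf (P N) (?x N) \<le> (\<Sum>j<N. qf (Q j) (?x j) + qf (R j) (v j))"
      using riccati_sum[OF P, of x0 v N] by linarith
    then have "ennreal (qf (P 0) x0 + ?e - qf (P N) (?x N)) \<le> ennreal (\<Sum>j<N. qf (Q j) (?x j) + qf (R j) (v j))"
      by (rule ennreal_leI)
    also have "\<dots> \<le> cost x0 v"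
      unfolding lqr_cost_eq by (rule le_suminf_ennreal) (rule stage_cost_nonneg)
    finally show ?thesis .
  qed
  then have "ennreal (qf (P 0) x0 + ?e - 0) \<le> cost x0 v"
    by (intro LIMSEQ_le_const2[OF lim]) blast
  then show ?thesis by simp
qed

lemma stable_feedback_cost_bound:
  assumes P: "cost_to_go K P" and st: "lyapunov_stable \<phi> (acl K)"
  obtains u where "\<And>k. u k = K k *v traj x0 u k" "stabilising A B x0 u"
    "cost x0 u \<le> ennreal (qf (P 0) x0)"
proof -
  note P = cost_to_goD[OF P]
  obtain u where u: "\<And>k. u k = K k *v traj x0 u k"
    "\<And>k. traj x0 u (Suc k) = acl K k *v traj x0 u k"
    using state_traj_feedback[where A = A and B = B and K = K and ?x0.0 = x0] by blast
  have sum: "(\<Sum>k<N. qf (Q k) (traj x0 u k) + qf (R k) (u k)) + qf (P N) (traj x0 u N) = qf (P 0) x0" for N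
  proof (induction N)
    case (Suc N)
    have "qf (P N) (traj x0 u N) = qf (weight K N + congr (acl K N) (P (Suc N))) (traj x0 u N)"
      by (rule arg_cong[where f = "\<lambda>M. qf M (traj x0 u N)", OF P(3)])
    also have "\<dots> = qf (Q N) (traj x0 u N) + qf (R N) (u N) + qf (P (Suc N)) (traj x0 u (Suc N))"
      unfolding u(2) using u(1)[of N] by (simp add: stage_weight_def)
    finally show ?case using Suc by (simp del: state_traj.simps)
  qed simp
  have "(\<Sum>k<N. qf (Q k) (traj x0 u k) + qf (R k) (u k)) \<le> qf (P 0) x0" for N
    using sum[of N] psd_nonneg[OF P(2), of N "traj x0 u N"] by linarith
  then have "cost x0 u \<le> ennreal (qf (P 0) x0)"
    unfolding lqr_cost_eq by (intro suminf_ennreal_le stage_cost_nonneg)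
  moreover have "stabilising A B x0 u"
    unfolding stabilising_def by (rule lyapunov_stable_tendsto_zero[OF st u(2)])
  ultimately show thesis using u(1) that by blast
qed

lemma stable_riccati_policy_optimal:
  assumes P: "riccati_solution P" and st: "lyapunov_stable \<phi> (acl (policy P))"
  shows "lqr_optimal_gain A B Q R (policy P)"
  unfolding lqr_optimal_gain_def
proof
  fix x0
  obtain u where u: "\<And>k. u k = policy P k *v traj x0 u k" "stabilising A B x0 u"
    "cost x0 u \<le> ennreal (qf (P 0) x0)"
    using stable_feedback_cost_bound[OF P[unfolded riccati_solution_def] st] by blast
  have "cost x0 u \<le> cost x0 v" if v: "stabilising A B x0 v" for v
  proof -
    have "ennreal (qf (P 0) x0) \<le> ennreal (qf (P 0) x0 + qf (R 0) (v 0 - policy P 0 *v traj x0 v 0))"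
      by (intro ennreal_leI) (simp add: psd_nonneg pd_psd pd_R del: state_traj.simps)
    also have "\<dots> \<le> cost x0 v" by (rule riccati_lower_bound[OF P v])
    finally show ?thesis using u(3) by (rule order.trans[rotated])
  qed
  then show "\<exists>u. (\<forall>k. u k = policy P k *v traj x0 u k) \<and> lqr_optimal A B Q R x0 u"
    using u unfolding lqr_optimal_def by blast
qed

text \<open>An optimal control need not come from a periodic gain, but it coincides with the
  Riccati feedback along its own trajectory: any deviation would cost something by \<open>riccati_lower_bound\<close>.\<close>

lemma cheap_control_is_riccati_feedback:
  assumes P: "riccati_solution P"
    and v: "stabilising A B x0 v" and cost: "cost x0 v \<le> ennreal (qf (P 0) x0)"
  shows "v i = policy P i *v traj x0 v i"
proof (rule ccontr)
  note PD = cost_to_goD[OF P[unfolded riccati_solution_def]]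
  assume "v i \<noteq> policy P i *v traj x0 v i"
  then have "0 < qf (R i) (v i - policy P i *v traj x0 v i)"
    using pd_R[of i] by (simp add: pd_iff del: qf_simps)
  moreover have "ennreal (qf (P 0) x0 + qf (R i) (v i - policy P i *v traj x0 v i)) \<le> ennreal (qf (P 0) x0)"
    using riccati_lower_bound[OF P v] cost by (rule order.trans)
  ultimately show False
    using psd_nonneg[OF PD(2), of 0 x0] by (simp add: ennreal_le_iff del: qf_simps)
qed

lemma policy_improvement_identity:
  assumes P: "cost_to_go K P"
  shows "qf (P k) x = qf (weight (policy P) k + congr (acl (policy P) k) (P (Suc k))) x
     + qf (R k + congr (B k) (P (Suc k))) ((K k - policy P k) *v x)"
proof -
  note P = cost_to_goD[OF P]
  have "qf (P k) x = qf (weight K k + congr (acl K k) (P (Suc k))) x"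
    by (rule arg_cong[where f = "\<lambda>M. qf M x", OF P(3)])
  also have "\<dots> = qf (Q k) x + qf (R k) (K k *v x) + qf (P (Suc k)) (A k *v x + B k *v (K k *v x))"
    by (simp add: stage_weight_def closed_loop_def matrix_vector_mult_add_rdistrib flip: matrix_vector_mul_assoc)
  also have "\<dots> = qf (weight (policy P) k + congr (acl (policy P) k) (P (Suc k))) x
     + qf (R k + congr (B k) (P (Suc k))) (K k *v x - policy P k *v x)"
    by (rule bellman_step[where P = P and Q = Q, OF pd_R P(2)])
  finally show ?thesis by (simp add: matrix_vector_mult_diff_rdistrib)
qed

text \<open>The greedy gain inherits stability although \<open>Q\<close> is only semidefinite. Under the
  greedy gain the old closed loop is perturbed by the input \<open>B k *v d\<close>, where \<open>d\<close> is the difference of the two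
  controls. The old certificate \<open>W\<close> absorbs such a perturbation up to a multiple of the form of \<open>R k\<close> at \<open>d\<close>, and by
  \<open>policy_improvement_identity\<close> the decrease of \<open>P\<close> pays for that multiple. So a combination of \<open>W\<close> and \<open>P\<close>
  is a certificate for the greedy gain.\<close>

lemma policy_improvement_stable:
  assumes P: "cost_to_go K P" and st: "lyapunov_stable \<phi> (acl K)"
  shows "lyapunov_stable \<phi> (acl (policy P))"
proof -
  note PD = cost_to_goD[OF P]
  define K' where "K' = policy P"
  obtain W where W: "periodic \<phi> W" "\<And>k. psd (W k)"
    "\<And>k. loewner_ge (W k) (mat 1 + congr (acl K k) (W (Suc k)))"
    using st unfolding lyapunov_stable_def by blast
  have "\<exists>b. \<forall>x. qf (W k) x \<le> b * (x \<bullet> x)" for k using qf_upper[of "W k"] by (metis abs_le_D1)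
  moreover have "periodic \<phi> (\<lambda>k. qf (W k))" "periodic \<phi> (\<lambda>k x::real^'n. x \<bullet> x)"
    using W(1) by (simp_all add: periodic_def)
  ultimately obtain \<beta> where \<beta>: "\<beta> > 0" "\<And>k x. qf (W k) x \<le> \<beta> * (x \<bullet> x)"
    using qf_uniform_bound[where f = "\<lambda>k. qf (W k)" and g = "\<lambda>k x. x \<bullet> x", OF period_pos]
      inner_ge_zero by blast
  \<comment> \<open>small enough that the factor \<open>1 + e\<close> uses up only half of the decrease of \<open>W\<close>\<close>
  define e where "e = 1 / (2 * \<beta>)"
  have e: "e > 0" "e * \<beta> = 1 / 2" using \<beta> by (auto simp: e_def)
  have "\<exists>b. \<forall>d. (1 + 1 / e) * qf (congr (B k) (W (Suc k))) d \<le> b * qf (R k) d" for k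
    using qf_bounded_by_pd[OF pd_R, of "(1 + 1 / e) *\<^sub>R congr (B k) (W (Suc k))" k] by (simp only: qf_simps)
  moreover have "periodic \<phi> (\<lambda>k d. (1 + 1 / e) * qf (congr (B k) (W (Suc k))) d)" "periodic \<phi> (\<lambda>k. qf (R k))"
    using per_B per_R W(1) unfolding periodic_def by (metis add_Suc, metis)
  ultimately obtain b where b: "b > 0"
    "\<And>k d. (1 + 1 / e) * qf (congr (B k) (W (Suc k))) d \<le> b * qf (R k) d"
    using qf_uniform_bound[where f = "\<lambda>k d. (1 + 1 / e) * qf (congr (B k) (W (Suc k))) d" and g = "\<lambda>k. qf (R k)", OF period_pos]
      psd_nonneg[OF pd_psd[OF pd_R]] by blast
  \<comment> \<open>the factor \<open>2\<close> restores a decrease by the full identity\<close>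
  define V where "V k = 2 *\<^sub>R W k + (2 * b) *\<^sub>R P k" for k
  have V: "psd (V k)" for k unfolding V_def using b by (intro psd_add psd_scaleR W PD) auto
  have "periodic \<phi> V" using W(1) PD(1) by (simp add: V_def periodic_def)
  moreover have "loewner_ge (V k) (mat 1 + congr (acl K' k) (V (Suc k)))" for k
  proof -
    have "x \<bullet> x + qf (V (Suc k)) (acl K' k *v x) \<le> qf (V k) x" for x
    proof -
      define a where "a = acl K k *v x"
      define d where "d = (K k - K' k) *v x"
      define y where "y = acl K' k *v x"
      have y: "y = a + B k *v ((-1) *\<^sub>R d)"
        by (simp add: y_def a_def d_def closed_loop_def algebra_simps matrix_vector_mul_assoc)
      have neg: "qf M ((-1) *\<^sub>R d) = qf M d" for M :: "real^'m^'m" unfolding qf_simps by simp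
      have "qf (W (Suc k)) y \<le> (1 + e) * qf (W (Suc k)) a + (1 + 1 / e) * qf (congr (B k) (W (Suc k))) ((-1) *\<^sub>R d)"
        unfolding y qf_congr by (rule qf_add_le[OF W(2) e(1)])
      also have "\<dots> \<le> (1 + e) * (qf (W k) x - x \<bullet> x) + b * qf (R k) d"
        using loewner_geD[OF W(3), of k x] e b(2)[of k d] unfolding neg
        by (intro add_mono mult_left_mono) (simp_all add: a_def)
      also have "(1 + e) * (qf (W k) x - x \<bullet> x) \<le> qf (W k) x - x \<bullet> x / 2"
      proof -
        have "e * qf (W k) x \<le> e * (\<beta> * (x \<bullet> x))" using \<beta> e by (intro mult_left_mono) auto
        also have "\<dots> = x \<bullet> x / 2" using e by (simp flip: mult.assoc)
        finally have "e * qf (W k) x \<le> x \<bullet> x / 2" .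
        moreover have "0 \<le> e * (x \<bullet> x)" using e by simp
        ultimately show ?thesis by (simp add: algebra_simps)
      qed
      finally have 1: "qf (W (Suc k)) y \<le> qf (W k) x - x \<bullet> x / 2 + b * qf (R k) d" by simp
      have "qf (R k) d + qf (P (Suc k)) y \<le> qf (P k) x"
        using policy_improvement_identity[OF P, of k x]
          psd_nonneg[OF psd_weight, of K' k x] psd_nonneg[OF PD(2), of "Suc k" "B k *v d"]
        by (simp add: K'_def[symmetric] d_def[symmetric] y_def)
      then have "b * (qf (R k) d + qf (P (Suc k)) y) \<le> b * qf (P k) x"
        using b by (intro mult_left_mono) auto
      with 1 show ?thesis by (simp add: V_def y_def[symmetric] algebra_simps)
    qed
    then show ?thesis
      using V by (simp add: loewner_ge_iff psd_sym psd_add psd_mat1 psd_congr)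
  qed
  ultimately show ?thesis using V unfolding lyapunov_stable_def K'_def by blast
qed

end

section \<open>Stabilising gains from asymptotic controllability\<close>

context periodic_lqr
begin

text \<open>\<open>value_iter N k\<close> is the form of the optimal cost of \<open>N\<close> steps from time \<open>k\<close> on, with no
  terminal cost.\<close>

primrec value_iter :: "nat \<Rightarrow> nat \<Rightarrow> real^'n^'n" where
  "value_iter 0 = (\<lambda>k. 0)"
| "value_iter (Suc N) = (\<lambda>k. weight (policy (value_iter N)) k
     + congr (acl (policy (value_iter N)) k) (value_iter N (Suc k)))"

lemma psd_value_iter: "psd (value_iter N k)"
  by (induction N arbitrary: k) (simp_all add: psd_zero psd_add psd_congr psd_weight)

lemma periodic_value_iter: "periodic \<phi> (value_iter N)"
proof (induction N)
  case 0 show ?case by (simp add: periodic_def)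
next
  case (Suc N)
  have "value_iter N (Suc (k + \<phi>)) = value_iter N (Suc k)" for k
    using Suc unfolding periodic_def by (metis add_Suc)
  then show ?case
    using periodic_stage_weight[OF per_Q per_R periodic_policy[OF Suc]]
      periodic_closed_loop[OF per_A per_B periodic_policy[OF Suc]]
    by (simp add: periodic_def)
qed

lemma value_iter_bellman:
  "qf (Q k) x + qf (R k) u + qf (value_iter N (Suc k)) (A k *v x + B k *v u) =
    qf (value_iter (Suc N) k) x
    + qf (R k + congr (B k) (value_iter N (Suc k))) (u - policy (value_iter N) k *v x)"
  unfolding value_iter.simps by (rule bellman_step[OF pd_R psd_value_iter])

lemma value_iter_le:
  "qf (value_iter (Suc N) k) x \<le> qf (Q k) x + qf (R k) u + qf (value_iter N (Suc k)) (A k *v x + B k *v u)"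
  unfolding value_iter_bellman
  using psd_nonneg[OF psd_input_hessian[OF psd_value_iter]] by (simp del: qf_simps value_iter.simps)

lemma value_iter_attained:
  "qf (value_iter (Suc N) k) x = qf (Q k) x + qf (R k) (policy (value_iter N) k *v x)
    + qf (value_iter N (Suc k)) (A k *v x + B k *v (policy (value_iter N) k *v x))"
  unfolding value_iter_bellman by (simp del: value_iter.simps)

lemma value_iter_increasing: "loewner_ge (value_iter (Suc N) k) (value_iter N k)"
proof -
  have "qf (value_iter N k) x \<le> qf (value_iter (Suc N) k) x" for x
  proof (induction N arbitrary: k x)
    case 0
    show ?case using psd_nonneg[OF psd_value_iter[of "Suc 0"]] by (simp del: value_iter.simps(2))
  next
    case (Suc N)
    show ?case
      using value_iter_le[of N k x "policy (value_iter (Suc N)) k *v x"]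
        Suc.IH[of "Suc k" "A k *v x + B k *v (policy (value_iter (Suc N)) k *v x)"]
      unfolding value_iter_attained[of "Suc N"] by linarith
  qed
  then show ?thesis by (simp add: loewner_ge_iff psd_sym psd_value_iter del: value_iter.simps)
qed

lemma value_iter_le_control:
  assumes "N \<le> M"
  shows "qf (value_iter M 0) x0 \<le> (\<Sum>i<N. qf (Q i) (traj x0 u i) + qf (R i) (u i))
    + qf (value_iter (M - N) N) (traj x0 u N)"
  using assms
proof (induction N)
  case (Suc N)
  then have "M - N = Suc (M - Suc N)" by simp
  then have "qf (value_iter (M - N) N) (traj x0 u N) \<le> qf (Q N) (traj x0 u N) + qf (R N) (u N)
      + qf (value_iter (M - Suc N) (Suc N)) (traj x0 u (Suc N))"
    using value_iter_le[of "M - Suc N" N "traj x0 u N" "u N"] by simp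
  then show ?case using Suc by (simp del: state_traj.simps)
qed simp

text \<open>Superposing stabilising controls for the unit vectors gives a control and a trajectory
  that are linear in the initial state.\<close>

lemma linear_control_family:
  assumes u: "\<And>x0. \<exists>u. stabilising A B x0 u"
  shows "\<exists>(\<Theta> :: nat \<Rightarrow> real^'n^'n) (\<Gamma> :: nat \<Rightarrow> real^'n^'m).
    (\<forall>x0 k. traj x0 (\<lambda>i. \<Gamma> i *v x0) k = \<Theta> k *v x0) \<and> \<Theta> \<longlonglongrightarrow> 0"
proof -
  obtain v where v: "\<And>x0. stabilising A B x0 (v x0)" using u by metis
  define \<Gamma> :: "nat \<Rightarrow> real^'n^'m" where "\<Gamma> i = (\<chi> r j. v (axis j 1) i $ r)" for i
  define \<Theta> where "\<Theta> = rec_nat (mat 1) (\<lambda>k T. A k ** T + B k ** \<Gamma> k)"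
  have \<Theta>: "\<Theta> 0 = mat 1" "\<Theta> (Suc k) = A k ** \<Theta> k + B k ** \<Gamma> k" for k by (simp_all add: \<Theta>_def)
  have tr: "traj x0 (\<lambda>i. \<Gamma> i *v x0) k = \<Theta> k *v x0" for x0 k
    by (induction k) (simp_all add: \<Theta> matrix_vector_mult_add_rdistrib flip: matrix_vector_mul_assoc)
  have "\<Gamma> i *v axis j 1 = v (axis j 1) i" for i j
    by (simp add: matrix_vector_mult_basis column_def \<Gamma>_def)
  then have "(\<lambda>k. \<Theta> k *v axis j 1) = traj (axis j 1) (v (axis j 1))" for j
    using tr[of "axis j 1"] by (simp add: fun_eq_iff)
  then have "(\<lambda>k. \<Theta> k *v axis j 1) \<longlonglongrightarrow> 0" for j
    using v[of "axis j 1"] by (simp add: stabilising_def)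
  then have "(\<lambda>k. (\<Theta> k *v axis j 1) $ i) \<longlonglongrightarrow> 0 $ i" for i j by (intro tendsto_vec_nth)
  then have "(\<lambda>k. \<Theta> k $ i $ j) \<longlonglongrightarrow> (0::real^'n^'n) $ i $ j" for i j
    by (simp add: matrix_vector_mult_basis column_def)
  then have "\<Theta> \<longlonglongrightarrow> 0" by (intro vec_tendstoI) auto
  with tr show ?thesis by blast
qed

text \<open>Asymptotic controllability bounds the optimal finite-horizon costs. After some number
  \<open>N\<close> of steps, a multiple of the period, the linear family of controls at least halves the squared norm of the
  state, at a cost \<open>a * (x \<bullet> x)\<close>. Starting again from there gives a geometric series with sum at most
  \<open>2 * a * (x \<bullet> x)\<close>. Other phases are reduced to phase \<open>0\<close> by applying no input until the period ends.\<close>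

lemma value_iter_bounded:
  assumes u: "\<And>x0. \<exists>u. stabilising A B x0 u"
  shows "\<exists>b. \<forall>M x. qf (value_iter M k) x \<le> b * (x \<bullet> x)"
proof -
  obtain \<Theta> :: "nat \<Rightarrow> real^'n^'n" and \<Gamma> :: "nat \<Rightarrow> real^'n^'m"
    where tr: "\<And>x0 k. traj x0 (\<lambda>i. \<Gamma> i *v x0) k = \<Theta> k *v x0" and lim: "\<Theta> \<longlonglongrightarrow> 0"
    using linear_control_family[OF u] by blast
  have "(\<lambda>k. trace (congr (\<Theta> k) (mat 1))) \<longlonglongrightarrow> trace (congr (0::real^'n^'n) (mat 1 :: real^'n^'n))"
    unfolding trace_def by (intro tendsto_intros tendsto_congr lim)
  then have "(\<lambda>k. trace (congr (\<Theta> k) (mat 1))) \<longlonglongrightarrow> 0" by (simp add: congr_def trace_def)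
  then have "\<forall>\<^sub>F k in sequentially. trace (congr (\<Theta> k) (mat 1)) < 1 / 2"
    by (rule order_tendstoD) simp
  then obtain p where p: "\<And>k. k \<ge> p \<Longrightarrow> trace (congr (\<Theta> k) (mat 1)) < 1 / 2"
    by (auto simp: eventually_sequentially)
  \<comment> \<open>at least \<open>p\<close>, positive, and at phase \<open>0\<close>\<close>
  define N where "N = Suc p * \<phi>"
  have N: "N \<ge> p" "N \<ge> 1" using period_pos by (auto simp: N_def intro: order.trans[OF _ le_add1] trans_le_add2)
  have contr: "(\<Theta> N *v x) \<bullet> (\<Theta> N *v x) \<le> x \<bullet> x / 2" for x
  proof -
    have "(\<Theta> N *v x) \<bullet> (\<Theta> N *v x) \<le> trace (congr (\<Theta> N) (mat 1)) * (x \<bullet> x)"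
      using qf_le_trace[OF psd_congr[OF psd_mat1], of "\<Theta> N" x] by simp
    also have "\<dots> \<le> 1 / 2 * (x \<bullet> x)" using p[OF N(1)] by (intro mult_right_mono) auto
    finally show ?thesis by simp
  qed
  have "qf (\<Sum>i<n. congr (\<Theta> i) (Q i) + congr (\<Gamma> i) (R i)) x =
      (\<Sum>i<n. qf (Q i) (\<Theta> i *v x) + qf (R i) (\<Gamma> i *v x))" for n x
    by (induction n) simp_all
  moreover obtain a where "a > 0" "\<And>x. \<bar>qf (\<Sum>i<N. congr (\<Theta> i) (Q i) + congr (\<Gamma> i) (R i)) x\<bar> \<le> a * (x \<bullet> x)"
    using qf_upper[of "\<Sum>i<N. congr (\<Theta> i) (Q i) + congr (\<Gamma> i) (R i)"] by blast
  ultimately have a: "a > 0" "\<And>x. (\<Sum>i<N. qf (Q i) (\<Theta> i *v x) + qf (R i) (\<Gamma> i *v x)) \<le> a * (x \<bullet> x)"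
    by (simp_all only: abs_le_iff)
  have b0: "qf (value_iter M 0) x \<le> 2 * a * (x \<bullet> x)" for M x
  proof (induction M arbitrary: x rule: less_induct)
    case (less M)
    note bnd = value_iter_le_control[of _ M x "\<lambda>i. \<Gamma> i *v x", unfolded tr]
    show ?case
    proof (cases "N \<le> M")
      case True
      have "value_iter (M - N) N = value_iter (M - N) 0"
        using periodic_mult[OF periodic_value_iter, of "M - N" 0 "Suc p"] by (simp add: N_def)
      moreover have "qf (value_iter (M - N) 0) (\<Theta> N *v x) \<le> 2 * a * ((\<Theta> N *v x) \<bullet> (\<Theta> N *v x))"
        using N True by (intro less) simp
      moreover have "2 * a * ((\<Theta> N *v x) \<bullet> (\<Theta> N *v x)) \<le> 2 * a * (x \<bullet> x / 2)"
        using contr a by (intro mult_left_mono) auto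
      ultimately show ?thesis using bnd[OF True] a(2)[of x] by simp
    next
      case False
      have "(\<Sum>i<M. qf (Q i) (\<Theta> i *v x) + qf (R i) (\<Gamma> i *v x)) \<le>
          (\<Sum>i<N. qf (Q i) (\<Theta> i *v x) + qf (R i) (\<Gamma> i *v x))"
        using False by (intro sum_mono2 stage_cost_nonneg) auto
      moreover have "0 \<le> a * (x \<bullet> x)" using a by simp
      ultimately show ?thesis using bnd[of M] a(2)[of x] by simp
    qed
  qed
  have step: "\<exists>b. \<forall>M x. qf (value_iter M k) x \<le> b * (x \<bullet> x)" if k: "k \<le> \<phi>" for k
    using k
  proof (induction k rule: inc_induct)
    case base
    have "value_iter M \<phi> = value_iter M 0" for M
      using periodic_value_iter[of M] unfolding periodic_def by (metis add_0)
    then show ?case using b0 by metis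
  next
    case (step k)
    then obtain b where b: "\<And>M x. qf (value_iter M (Suc k)) x \<le> b * (x \<bullet> x)" by blast
    obtain c where "c > 0" "\<And>x. \<bar>qf (Q k + b *\<^sub>R congr (A k) (mat 1)) x\<bar> \<le> c * (x \<bullet> x)"
      using qf_upper[of "Q k + b *\<^sub>R congr (A k) (mat 1)"] by blast
    then have c: "c > 0" "\<And>x. qf (Q k + b *\<^sub>R congr (A k) (mat 1)) x \<le> c * (x \<bullet> x)"
      by (simp_all only: abs_le_iff)
    have "qf (value_iter M k) x \<le> c * (x \<bullet> x)" for M x
    proof (cases M)
      case 0 then show ?thesis using c by simp
    next
      case (Suc M')
      have "qf (value_iter (Suc M') k) x \<le> qf (Q k) x + qf (value_iter M' (Suc k)) (A k *v x)"
        using value_iter_le[of M' k x 0] by (simp del: value_iter.simps)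
      also have "\<dots> \<le> qf (Q k + b *\<^sub>R congr (A k) (mat 1)) x" using b[of M' "A k *v x"] by simp
      finally show ?thesis using c(2)[of x] Suc by (simp del: value_iter.simps)
    qed
    then show ?case by blast
  qed
  have "k mod \<phi> \<le> \<phi>" using period_pos by (simp add: less_imp_le)
  from step[OF this] show ?thesis by (simp only: periodic_mod[OF periodic_value_iter])
qed

text \<open>Bounded and increasing, the value iteration converges, so some step changes it
  by at most half the identity. As every stage costs at least \<open>x \<bullet> x\<close>, the iterate then decreases along its
  greedy gain by at least half of this, and twice the iterate is a certificate.\<close>

lemma stabilising_gain_if_weight_ge_mat1:
  assumes u: "\<And>x0. \<exists>u. stabilising A B x0 u" and Q: "\<And>k. loewner_ge (Q k) (mat 1)"
  shows "\<exists>K. periodic \<phi> K \<and> lyapunov_stable \<phi> (acl K)"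
proof -
  have "\<exists>L. (\<lambda>N. value_iter N k) \<longlonglongrightarrow> L" for k
    using value_iter_bounded[OF u, of k]
    by (intro psd_increasing_converges value_iter_increasing psd_sym[OF psd_value_iter]) blast
  then obtain L where L: "\<And>k. (\<lambda>N. value_iter N k) \<longlonglongrightarrow> L k" by metis
  have "(\<lambda>N. trace (value_iter (Suc N) k - value_iter N k)) \<longlonglongrightarrow> trace (L k - L k)" for k
    unfolding trace_def by (intro tendsto_intros L LIMSEQ_Suc)
  then have "\<forall>\<^sub>F N in sequentially. trace (value_iter (Suc N) k - value_iter N k) < 1 / 2" for k
    by (intro order_tendstoD(2)[where y = "trace (L k - L k)"]) (simp_all add: trace_def)
  then have "\<forall>\<^sub>F N in sequentially. \<forall>k\<in>{..<\<phi>}. trace (value_iter (Suc N) k - value_iter N k) < 1 / 2"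
    by (intro eventually_ball_finite) auto
  then have "\<exists>N. \<forall>k\<in>{..<\<phi>}. trace (value_iter (Suc N) k - value_iter N k) < 1 / 2"
    by (rule eventually_happens'[OF sequentially_bot])
  then obtain N where N: "\<And>k. k < \<phi> \<Longrightarrow> trace (value_iter (Suc N) k - value_iter N k) < 1 / 2"
    unfolding Ball_def lessThan_iff by blast
  have near: "qf (value_iter (Suc N) k) x \<le> qf (value_iter N k) x + x \<bullet> x / 2" for k x
  proof -
    have "k mod \<phi> < \<phi>" using period_pos by simp
    from N[OF this] have "trace (value_iter (Suc N) k - value_iter N k) \<le> 1 / 2"
      by (simp add: periodic_mod[OF periodic_value_iter] del: value_iter.simps)
    then have "trace (value_iter (Suc N) k - value_iter N k) * (x \<bullet> x) \<le> 1 / 2 * (x \<bullet> x)"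
      by (intro mult_right_mono) auto
    then show ?thesis
      using qf_le_trace[OF value_iter_increasing[unfolded loewner_ge_def], of N k x]
      by (simp del: value_iter.simps)
  qed
  define K where "K = policy (value_iter N)"
  have "loewner_ge (2 *\<^sub>R value_iter N k) (mat 1 + congr (acl K k) (2 *\<^sub>R value_iter N (Suc k)))" for k
  proof -
    have "x \<bullet> x + 2 * qf (value_iter N (Suc k)) (acl K k *v x) \<le> 2 * qf (value_iter N k) x" for x
    proof -
      have "x \<bullet> x + qf (value_iter N (Suc k)) (acl K k *v x) \<le> qf (value_iter (Suc N) k) x"
        using loewner_geD[OF Q, of x k] psd_nonneg[OF pd_psd[OF pd_R], of k "K k *v x"]
        by (simp add: stage_weight_def K_def[symmetric])
      then show ?thesis using near[of k x] by linarith
    qed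
    then show ?thesis
      by (subst loewner_ge_iff)
        (simp_all add: psd_sym psd_add psd_mat1 psd_congr psd_scaleR psd_value_iter)
  qed
  moreover have "periodic \<phi> (\<lambda>k. 2 *\<^sub>R value_iter N k)" using periodic_value_iter by (simp add: periodic_def)
  ultimately have "lyapunov_stable \<phi> (acl K)"
    unfolding lyapunov_stable_def
    by (intro exI[of _ "\<lambda>k. 2 *\<^sub>R value_iter N k"]) (simp add: psd_scaleR psd_value_iter)
  then show ?thesis using periodic_policy[OF periodic_value_iter] K_def by blast
qed

end

lemma stabilising_periodic_gain_exists:
  assumes "\<phi> \<ge> 1" "periodic \<phi> A" "periodic \<phi> (B :: nat \<Rightarrow> real^'m^'n)"
    and "\<And>x0. \<exists>u. stabilising A B x0 u"
  shows "\<exists>K. periodic \<phi> K \<and> lyapunov_stable \<phi> (closed_loop A B K)"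
proof -
  have pd1: "pd (mat 1 :: real^'m^'m)" by (simp add: pd_iff)
  interpret periodic_lqr \<phi> A B "\<lambda>_. mat 1" "\<lambda>_. mat 1"
    using assms(1-3) pd1 by unfold_locales (auto simp: periodic_def psd_mat1)
  show ?thesis
    by (rule stabilising_gain_if_weight_ge_mat1) (simp_all add: assms(4) loewner_ge_def psd_zero)
qed

text \<open>An autonomous system is a control system with zero input matrix, for which
  every gain gives the same closed loop.\<close>

lemma lyapunov_stable_if_tendsto_zero:
  fixes M :: "nat \<Rightarrow> real^'n^'n"
  assumes "\<phi> \<ge> 1" "periodic \<phi> M"
    and x: "\<And>x0. \<exists>x. x 0 = x0 \<and> (\<forall>k. x (Suc k) = M k *v x k) \<and> x \<longlonglongrightarrow> 0"
  shows "lyapunov_stable \<phi> M"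
proof -
  define B where "B = (\<lambda>k::nat. 0 :: real^'n^'n)"
  have "\<exists>u. stabilising M B x0 u" for x0
  proof -
    obtain x where x: "x 0 = x0" "\<And>k. x (Suc k) = M k *v x k" "x \<longlonglongrightarrow> 0" using x by blast
    have "state_traj M B x0 (\<lambda>_. 0) k = x k" for k
      by (induction k) (simp_all add: x(1,2) B_def)
    then have "state_traj M B x0 (\<lambda>_. 0) = x" by blast
    then show ?thesis using x(3) unfolding stabilising_def by metis
  qed
  then obtain K where "lyapunov_stable \<phi> (closed_loop M B K)"
    using stabilising_periodic_gain_exists[of \<phi> M B] assms(1,2) by (auto simp: B_def periodic_def)
  moreover have "closed_loop M B K = M" by (simp add: closed_loop_def B_def fun_eq_iff)
  ultimately show ?thesis by simp
qed

section \<open>Policy iteration\<close>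

context periodic_lqr
begin

text \<open>The cost matrices of stabilising periodic gains: the states of the policy iteration.\<close>

definition admissible :: "(nat \<Rightarrow> real^'n^'n) \<Rightarrow> bool" where
  "admissible P \<longleftrightarrow> (\<exists>K. periodic \<phi> K \<and> lyapunov_stable \<phi> (acl K) \<and> cost_to_go K P)"

lemma cost_to_go_exists:
  assumes K: "periodic \<phi> K" and st: "lyapunov_stable \<phi> (acl K)"
  obtains P where "cost_to_go K P"
    "\<And>W k. periodic \<phi> W \<Longrightarrow> (\<And>k. psd (W k)) \<Longrightarrow>
       (\<And>k. loewner_ge (W k) (weight K k + congr (acl K k) (W (Suc k)))) \<Longrightarrow> loewner_ge (W k) (P k)"
proof -
  note per = periodic_closed_loop[OF per_A per_B K]
  obtain S where S: "periodic \<phi> S" "\<forall>k. psd (S k)" "\<forall>k. S (Suc k) = mat 1 + congr (transpose (acl K k)) (S k)"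
    using lyapunov_stable_gramian[OF period_pos per st] by blast
  have "loewner_ge (S (Suc k)) (mat 1 + congr (transpose (acl K k)) (S k))" for k
    using S(3) by (simp add: loewner_ge_def psd_zero)
  from lyapunov_duality[where C = "weight K" and S = S, OF period_pos per periodic_stage_weight[OF per_Q per_R K] S(1)
      psd_weight S(2)[rule_format] this]
  obtain P where P: "periodic \<phi> P" "\<forall>k. psd (P k)" "\<forall>k. P k = weight K k + congr (acl K k) (P (Suc k))"
    "\<forall>W. periodic \<phi> W \<longrightarrow> (\<forall>k. psd (W k) \<and> loewner_ge (W k) (weight K k + congr (acl K k) (W (Suc k)))) \<longrightarrow>
       (\<forall>k. loewner_ge (W k) (P k))" by blast
  show thesis
  proof (rule that)
    show "cost_to_go K P" using P(1-3) unfolding cost_to_go_def by blast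
  qed (use P(4) in blast)
qed

text \<open>By \<open>policy_improvement_identity\<close> the old cost is a supersolution of the Lyapunov
  equation of the greedy gain, and the new cost is the least one.\<close>

lemma policy_iteration_step:
  assumes "admissible P"
  shows "\<exists>P'. admissible P' \<and> cost_to_go (policy P) P' \<and> (\<forall>k. loewner_ge (P k) (P' k))"
proof -
  obtain K where K: "periodic \<phi> K" "lyapunov_stable \<phi> (acl K)" "cost_to_go K P"
    using assms unfolding admissible_def by blast
  note PD = cost_to_goD[OF K(3)]
  have per: "periodic \<phi> (policy P)" by (rule periodic_policy[OF PD(1)])
  have st: "lyapunov_stable \<phi> (acl (policy P))" by (rule policy_improvement_stable[OF K(3,2)])
  obtain P' where P': "cost_to_go (policy P) P'"
    "\<And>W k. periodic \<phi> W \<Longrightarrow> (\<And>k. psd (W k)) \<Longrightarrow>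
       (\<And>k. loewner_ge (W k) (weight (policy P) k + congr (acl (policy P) k) (W (Suc k)))) \<Longrightarrow> loewner_ge (W k) (P' k)"
    using cost_to_go_exists[OF per st] by blast
  have "loewner_ge (P k) (weight (policy P) k + congr (acl (policy P) k) (P (Suc k)))" for k
    using policy_improvement_identity[OF K(3), of k] psd_nonneg[OF psd_input_hessian[OF PD(2)]]
    by (subst loewner_ge_iff)
      (simp_all add: psd_sym PD(2) psd_add psd_weight psd_congr del: qf_simps)
  then have "loewner_ge (P k) (P' k)" for k by (intro P'(2) PD(1,2))
  then show ?thesis using P'(1) per st unfolding admissible_def by blast
qed

text \<open>The policy iteration decreases and its limit \<open>P\<close> solves the Riccati equation. The
  limiting gain need not stabilise, but \<open>P\<close> is approximated by costs of stabilising controls. Hence no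
  lower bound \<open>c\<close> for the cost of stabilising controls exceeds the value of \<open>P\<close>.\<close>

lemma riccati_solution_exists:
  assumes ex: "\<exists>K. periodic \<phi> K \<and> lyapunov_stable \<phi> (acl K)"
  obtains P where "riccati_solution P"
    "\<And>x0 c. (\<And>u. stabilising A B x0 u \<Longrightarrow> c \<le> cost x0 u) \<Longrightarrow> c \<le> ennreal (qf (P 0) x0)"
proof -
  have "\<exists>P. admissible P" using ex cost_to_go_exists unfolding admissible_def by metis
  then obtain Ps where Ps: "\<And>N. admissible (Ps N)" "\<And>N. cost_to_go (policy (Ps N)) (Ps (Suc N))"
    "\<And>N k. loewner_ge (Ps N k) (Ps (Suc N) k)"
    using dependent_nat_choice[where P = "\<lambda>_. admissible"
        and Q = "\<lambda>_ P P'. cost_to_go (policy P) P' \<and> (\<forall>k. loewner_ge (P k) (P' k))"]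
      policy_iteration_step by metis
  have psd: "psd (Ps N k)" and per: "periodic \<phi> (Ps N)" for N k
    using Ps(1)[of N] cost_to_goD unfolding admissible_def by blast+
  have "\<exists>L. (\<lambda>N. Ps N k) \<longlonglongrightarrow> L" for k
  proof -
    \<comment> \<open>a decreasing sequence, turned into an increasing one\<close>
    have "\<exists>L. (\<lambda>N. Ps 0 k - Ps N k) \<longlonglongrightarrow> L"
    proof (rule psd_increasing_converges)
      show "transpose (Ps 0 k - Ps N k) = Ps 0 k - Ps N k" for N by (simp add: transpose_diff psd_sym psd)
      show "loewner_ge (Ps 0 k - Ps (Suc N) k) (Ps 0 k - Ps N k)" for N
        using Ps(3)[of N k] by (simp add: loewner_ge_def)
      show "\<exists>b. \<forall>N. qf (Ps 0 k - Ps N k) x \<le> b" for x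
        using psd_nonneg[OF psd, of _ k x] by (intro exI[of _ "qf (Ps 0 k) x"]) simp
    qed
    then obtain L where "(\<lambda>N. Ps 0 k - Ps N k) \<longlonglongrightarrow> L" ..
    then have "(\<lambda>N. Ps 0 k - (Ps 0 k - Ps N k)) \<longlonglongrightarrow> Ps 0 k - L" by (intro tendsto_intros)
    then show ?thesis by auto
  qed
  then obtain P where lim: "\<And>k. (\<lambda>N. Ps N k) \<longlonglongrightarrow> P k" by metis
  have psdP: "psd (P k)" for k by (rule psd_limit[OF lim psd])
  have "P (k + \<phi>) = P k" for k
    using lim[of "k + \<phi>"] lim[of k] per unfolding periodic_def by (simp add: LIMSEQ_unique)
  then have perP: "periodic \<phi> P" by (simp add: periodic_def)
  have pol: "(\<lambda>N. policy (Ps N) k) \<longlonglongrightarrow> policy P k" for k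
    unfolding riccati_policy_def by (intro lqr_gain_tendsto pd_R lim psd)
  have "P k = weight (policy P) k + congr (acl (policy P) k) (P (Suc k))" for k
  proof (rule LIMSEQ_unique)
    show "(\<lambda>N. Ps (Suc N) k) \<longlonglongrightarrow> P k" by (rule LIMSEQ_Suc[OF lim])
    have "(\<lambda>N. weight (policy (Ps N)) k + congr (acl (policy (Ps N)) k) (Ps (Suc N) (Suc k)))
      \<longlonglongrightarrow> weight (policy P) k + congr (acl (policy P) k) (P (Suc k))"
      unfolding stage_weight_def closed_loop_def
      by (intro tendsto_intros tendsto_congr tendsto_matrix_mult pol LIMSEQ_Suc[OF lim])
    moreover have "(\<lambda>N. weight (policy (Ps N)) k + congr (acl (policy (Ps N)) k) (Ps (Suc N) (Suc k))) =
        (\<lambda>N. Ps (Suc N) k)"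
      by (rule ext) (rule cost_to_goD(3)[OF Ps(2), symmetric])
    ultimately show "(\<lambda>N. Ps (Suc N) k) \<longlonglongrightarrow> weight (policy P) k + congr (acl (policy P) k) (P (Suc k))"
      by (simp only:)
  qed
  then have ric: "riccati_solution P"
    using perP psdP unfolding riccati_solution_def cost_to_go_def by blast
  have "c \<le> ennreal (qf (P 0) x0)" if c: "\<And>u. stabilising A B x0 u \<Longrightarrow> c \<le> cost x0 u" for x0 c
  proof (rule LIMSEQ_le_const)
    show "(\<lambda>N. ennreal (qf (Ps N 0) x0)) \<longlonglongrightarrow> ennreal (qf (P 0) x0)"
      by (intro tendsto_ennrealI tendsto_qf lim tendsto_const)
    \<comment> \<open>compare with the feedback whose cost is \<open>Ps N\<close>\<close>
    have "c \<le> ennreal (qf (Ps N 0) x0)" for N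
    proof -
      obtain K where K: "lyapunov_stable \<phi> (acl K)" "cost_to_go K (Ps N)"
        using Ps(1)[of N] unfolding admissible_def by blast
      obtain u where "stabilising A B x0 u" "cost x0 u \<le> ennreal (qf (Ps N 0) x0)"
        using stable_feedback_cost_bound[OF K(2,1)] by blast
      then show ?thesis using c order.trans by blast
    qed
    then show "\<exists>n0. \<forall>N\<ge>n0. c \<le> ennreal (qf (Ps N 0) x0)" by blast
  qed
  with ric show thesis by (rule that)
qed

end

section \<open>Minimisers of the programme and optimal gains\<close>

locale periodic_lqr_data = periodic_lqr \<phi> A B Q R
  for \<phi> and A :: "nat \<Rightarrow> real^'n^'n" and B :: "nat \<Rightarrow> real^'m^'n" and Q R +
  fixes X :: "nat \<Rightarrow> real^'l^'n" and U :: "nat \<Rightarrow> real^'l^'m"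
  assumes data: "\<forall>k<\<phi>. X (k + 1) = A k ** X k + B k ** U k"
    and rank: "\<forall>k<\<phi>. rank (vstack (X k) (U k)) = CARD('n) + CARD('m)"
begin

text \<open>The programme constrains one period only; \<open>S \<phi> = S 0\<close> makes the wrap-around
  step of the periodic extension consistent.\<close>

lemma sdp_feasible_periodic_extension:
  assumes feas: "sdp_feasible \<phi> X U R S H Y"
    and K: "\<forall>k<\<phi>. K k = U k ** H k ** matrix_inv (S k)" and per: "periodic \<phi> K"
  obtains T where "periodic \<phi> T" "\<And>k. loewner_ge (T k) (mat 1)"
    "\<And>k. loewner_ge (T (Suc k)) (mat 1 + congr (transpose (acl K k)) (T k))"
    "(\<Sum>k<\<phi>. trace (weight K k ** T k)) \<le> sdp_objective \<phi> Q S Y"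
proof -
  note lyap = sdp_feasible_imp_lyapunov[OF feas data allI[where P = "\<lambda>k. pd (R k)", OF pd_R] K]
  define T where "T k = S (k mod \<phi>)" for k
  have lt: "k mod \<phi> < \<phi>" for k using period_pos by simp
  have T_Suc: "T (Suc k) = S (Suc (k mod \<phi>))" for k
  proof (cases "Suc (k mod \<phi>) = \<phi>")
    case True
    then have "Suc k mod \<phi> = 0" by (metis mod_Suc_eq mod_self)
    then show ?thesis using feas True by (simp add: T_def sdp_feasible_def)
  next
    case False
    then show ?thesis by (simp add: T_def mod_Suc)
  qed
  show thesis
  proof (rule that[of T])
    show "periodic \<phi> T" by (simp add: periodic_def T_def)
    show "loewner_ge (T k) (mat 1)" for k
      unfolding T_def using lt[of k] by (intro lyap(1)) auto
    show "loewner_ge (T (Suc k)) (mat 1 + congr (transpose (acl K k)) (T k))" for k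
      using lyap(2)[OF lt[of k]] periodic_mod[OF periodic_closed_loop[OF per_A per_B per], of k]
      unfolding T_Suc by (simp add: T_def)
    show "(\<Sum>k<\<phi>. trace (weight K k ** T k)) \<le> sdp_objective \<phi> Q S Y"
      unfolding sdp_objective_def by (intro sum_mono) (simp add: T_def lyap(3))
  qed
qed

lemma gramian_sdp_feasible:
  assumes S: "periodic \<phi> S" "\<And>k. loewner_ge (S k) (mat 1)"
    and eq: "\<And>k. S (Suc k) = mat 1 + congr (transpose (acl K k)) (S k)"
  obtains H Y where "sdp_feasible \<phi> X U R S H Y"
    "sdp_objective \<phi> Q S Y = (\<Sum>k<\<phi>. trace (weight K k ** S k))"
proof -
  have ge: "loewner_ge (S (Suc k)) (mat 1 + congr (transpose (acl K k)) (S k))" for k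
    by (simp add: eq loewner_ge_def psd_zero)
  have "S \<phi> = S 0" using S(1) by (metis add_0 periodic_def)
  from lyapunov_imp_sdp_feasible[OF data rank allI[where P = "\<lambda>k. pd (R k)", OF pd_R] S(2) this ge] show thesis
    using that by blast
qed

text \<open>Let \<open>P\<close> be the cost of the gain \<open>K\<close> of a minimiser; by duality its total trace
  is at most the minimum. The greedy gain for \<open>P\<close> stabilises too, so its Gramian is a feasible
  competitor, whose objective falls short of the total trace of \<open>P\<close> by the traces of \<open>D k ** S' k\<close>, where
  \<open>D\<close> measures the distance of \<open>K\<close> to the greedy gain. Minimality forces \<open>D = 0\<close>, so \<open>K\<close> is greedy for its
  own cost, that is, \<open>P\<close> solves the Riccati equation.\<close>

lemma sdp_solution_gain_optimal:
  assumes sol: "sdp_solution \<phi> X U Q R S H Y"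
    and K: "\<forall>k<\<phi>. K k = U k ** H k ** matrix_inv (S k)" and per: "periodic \<phi> K"
  shows "lqr_optimal_gain A B Q R K"
proof -
  have feas: "sdp_feasible \<phi> X U R S H Y" using sol by (simp add: sdp_solution_def)
  obtain T where T: "periodic \<phi> T" "\<And>k. loewner_ge (T k) (mat 1)"
    "\<And>k. loewner_ge (T (Suc k)) (mat 1 + congr (transpose (acl K k)) (T k))"
    "(\<Sum>k<\<phi>. trace (weight K k ** T k)) \<le> sdp_objective \<phi> Q S Y"
    using sdp_feasible_periodic_extension[OF feas K per] by blast
  have Tpsd: "psd (T k)" for k by (rule loewner_ge_psd[OF psd_mat1 T(2)])
  note per_acl = periodic_closed_loop[OF per_A per_B per]
  have st: "lyapunov_stable \<phi> (acl K)" by (rule lyapunov_stable_of_dual[OF period_pos per_acl T(1) Tpsd T(3)])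
  from lyapunov_duality[where C = "weight K" and S = T, OF period_pos per_acl
      periodic_stage_weight[OF per_Q per_R per] T(1) psd_weight Tpsd T(3)]
  obtain P where P: "cost_to_go K P" "(\<Sum>k<\<phi>. trace (P k)) \<le> (\<Sum>k<\<phi>. trace (weight K k ** T k))"
    unfolding cost_to_go_def by blast
  note PD = cost_to_goD[OF P(1)]
  \<comment> \<open>the improvement that the greedy gain achieves in one step, by \<open>policy_improvement_identity\<close>\<close>
  define D where "D k = congr (K k - policy P k) (R k + congr (B k) (P (Suc k)))" for k
  have D: "psd (D k)" for k unfolding D_def by (intro psd_congr psd_input_hessian PD)
  have per': "periodic \<phi> (policy P)" by (rule periodic_policy[OF PD(1)])
  have st': "lyapunov_stable \<phi> (acl (policy P))" by (rule policy_improvement_stable[OF P(1) st])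
  obtain S' where S': "periodic \<phi> S'" "\<And>k. psd (S' k)" "\<And>k. loewner_ge (S' k) (mat 1)"
    "\<And>k. S' (Suc k) = mat 1 + congr (transpose (acl (policy P) k)) (S' k)"
    using lyapunov_stable_gramian[OF period_pos periodic_closed_loop[OF per_A per_B per'] st'] by blast
  obtain H' Y' where H': "sdp_feasible \<phi> X U R S' H' Y'"
    "sdp_objective \<phi> Q S' Y' = (\<Sum>k<\<phi>. trace (weight (policy P) k ** S' k))"
    using gramian_sdp_feasible[OF S'(1,3,4)] by blast
  have "P k = weight (policy P) k + congr (acl (policy P) k) (P (Suc k)) + D k" for k
  proof (rule sym_matrix_eqI)
    show "transpose (weight (policy P) k + congr (acl (policy P) k) (P (Suc k)) + D k) =
        weight (policy P) k + congr (acl (policy P) k) (P (Suc k)) + D k"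
      by (intro psd_sym psd_add psd_weight psd_congr PD D)
    show "qf (P k) x = qf (weight (policy P) k + congr (acl (policy P) k) (P (Suc k)) + D k) x" for x
      using policy_improvement_identity[OF P(1), of k x] unfolding D_def
      by (simp only: qf_simps(1) qf_congr)
  qed (rule psd_sym[OF PD(2)])
  from lyapunov_trace_identity[where E = "\<lambda>_. 0", OF PD(1) S'(1) this] S'(4)
  have "(\<Sum>k<\<phi>. trace (weight (policy P) k ** S' k)) = (\<Sum>k<\<phi>. trace (P k)) - (\<Sum>k<\<phi>. trace (D k ** S' k))"
    by (simp add: trace_def)
  moreover have "sdp_objective \<phi> Q S Y \<le> sdp_objective \<phi> Q S' Y'"
    using sol H'(1) by (simp add: sdp_solution_def)
  moreover have "(\<Sum>k<\<phi>. trace (D k)) \<le> (\<Sum>k<\<phi>. trace (D k ** S' k))"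
    using trace_mult_mono_right[OF D S'(3)] by (intro sum_mono) simp
  ultimately have sum0: "(\<Sum>k<\<phi>. trace (D k)) \<le> 0" using H'(2) P(2) T(4) by linarith
  have D0: "D k = 0" if k: "k < \<phi>" for k
  proof (rule psd_trace_zero[OF D])
    have "trace (D k) \<le> (\<Sum>k<\<phi>. trace (D k))"
      using k by (intro member_le_sum trace_psd_nonneg D) auto
    then show "trace (D k) \<le> 0" using sum0 by linarith
  qed
  have "K k = policy P k" if k: "k < \<phi>" for k
  proof -
    have "(K k - policy P k) *v x = 0" for x
    proof (rule ccontr)
      assume "(K k - policy P k) *v x \<noteq> 0"
      moreover have "pd (R k + congr (B k) (P (Suc k)))" by (intro pd_add_psd pd_R psd_congr PD)
      ultimately have "0 < qf (D k) x" unfolding D_def qf_congr pd_iff by blast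
      then show False by (simp add: D0[OF k])
    qed
    then have "K k - policy P k = 0" by (simp add: matrix_eq)
    then show ?thesis by simp
  qed
  then have "K = policy P"
    using periodic_eqI[OF per per' period_pos] by blast
  then show ?thesis
    using stable_riccati_policy_optimal[of P] P(1) st by (simp add: riccati_solution_def)
qed

text \<open>The Riccati solution is a dual certificate: it is a subsolution of the Lyapunov equation
  of every gain, by \<open>bellman_step\<close>, and every feasible point carries a supersolution on the other side, so both
  defects in \<open>lyapunov_trace_identity\<close> have the favourable sign.\<close>

lemma sdp_objective_ge_riccati:
  assumes ric: "riccati_solution P" and feas: "sdp_feasible \<phi> X U R S H Y"
  shows "(\<Sum>k<\<phi>. trace (P k)) \<le> sdp_objective \<phi> Q S Y"
proof -
  note PD = cost_to_goD[OF ric[unfolded riccati_solution_def]]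
  define K where "K k = U (k mod \<phi>) ** H (k mod \<phi>) ** matrix_inv (S (k mod \<phi>))" for k
  have K: "periodic \<phi> K" "\<forall>k<\<phi>. K k = U k ** H k ** matrix_inv (S k)"
    by (simp_all add: K_def periodic_def)
  obtain T where T: "periodic \<phi> T" "\<And>k. loewner_ge (T k) (mat 1)"
    "\<And>k. loewner_ge (T (Suc k)) (mat 1 + congr (transpose (acl K k)) (T k))"
    "(\<Sum>k<\<phi>. trace (weight K k ** T k)) \<le> sdp_objective \<phi> Q S Y"
    using sdp_feasible_periodic_extension[OF feas K(2,1)] by blast
  have Tpsd: "psd (T k)" for k by (rule loewner_ge_psd[OF psd_mat1 T(2)])
  define D where "D k = P k - (weight K k + congr (acl K k) (P (Suc k)))" for k
  define E where "E k = T (Suc k) - (mat 1 + congr (transpose (acl K k)) (T k))" for k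
  have E: "psd (E k)" for k using T(3) by (simp add: E_def loewner_ge_def)
  have D: "loewner_ge 0 (D k)" for k
  proof -
    have "qf (P k) x \<le> qf (weight K k + congr (acl K k) (P (Suc k))) x" for x
    proof -
      have "qf (P k) x = qf (weight (policy P) k + congr (acl (policy P) k) (P (Suc k))) x"
        by (rule arg_cong[where f = "\<lambda>M. qf M x", OF PD(3)])
      also have "\<dots> \<le> qf (Q k) x + qf (R k) (K k *v x) + qf (P (Suc k)) (A k *v x + B k *v (K k *v x))"
        using bellman_step[where A = A and B = B and P = P and Q = Q and R = R and k = k and x = x and u = "K k *v x",
            OF pd_R PD(2)]
          psd_nonneg[OF psd_input_hessian[OF PD(2)[of "Suc k"]], of k "K k *v x - policy P k *v x"]
        by linarith
      also have "\<dots> = qf (weight K k + congr (acl K k) (P (Suc k))) x"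
        by (simp add: stage_weight_def closed_loop_def matrix_vector_mult_add_rdistrib flip: matrix_vector_mul_assoc)
      finally show ?thesis .
    qed
    then show ?thesis
      by (subst loewner_ge_iff)
        (simp_all add: transpose_zero D_def transpose_diff psd_sym PD(2) psd_add psd_weight psd_congr)
  qed
  have "(\<Sum>k<\<phi>. trace (weight K k ** T k)) = (\<Sum>k<\<phi>. trace (P k))
      + (\<Sum>k<\<phi>. trace (P (Suc k) ** E k)) - (\<Sum>k<\<phi>. trace (D k ** T k))"
    by (rule lyapunov_trace_identity[OF PD(1) T(1)]) (simp_all add: D_def E_def)
  moreover have "0 \<le> (\<Sum>k<\<phi>. trace (P (Suc k) ** E k))"
    by (intro sum_nonneg trace_mult_psd_nonneg PD E)
  moreover have "(\<Sum>k<\<phi>. trace (D k ** T k)) \<le> 0"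
    using trace_mult_mono_left[OF Tpsd D] by (intro sum_nonpos) (simp add: trace_def)
  ultimately show ?thesis using T(4) by linarith
qed

text \<open>The optimal controls stabilise, so the policy iteration has
  a starting point and a limit \<open>P\<close>; they cost at most what \<open>P\<close> says, so they follow the Riccati gain of \<open>P\<close>.
  Therefore this periodic gain drives every initial state to zero, it has a Gramian, and the corresponding feasible
  point attains the lower bound \<open>sdp_objective_ge_riccati\<close>. The given gain itself may be aperiodic, and
  it is used only through its trajectories.\<close>

lemma optimal_gain_imp_sdp_solution:
  assumes "lqr_optimal_gain A B Q R K"
  shows "\<exists>S H Y. sdp_solution \<phi> X U Q R S H Y"
proof -
  obtain u where u: "\<And>x0. lqr_optimal A B Q R x0 (u x0)"
    using assms unfolding lqr_optimal_gain_def by metis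
  have st: "stabilising A B x0 (u x0)" for x0 using u unfolding lqr_optimal_def by blast
  then have "\<exists>K. periodic \<phi> K \<and> lyapunov_stable \<phi> (acl K)"
    by (intro stabilising_periodic_gain_exists[OF period_pos per_A per_B]) blast
  then obtain P where ric: "riccati_solution P"
    and P: "\<And>x0 c. (\<And>u. stabilising A B x0 u \<Longrightarrow> c \<le> cost x0 u) \<Longrightarrow> c \<le> ennreal (qf (P 0) x0)"
    using riccati_solution_exists by blast
  note PD = cost_to_goD[OF ric[unfolded riccati_solution_def]]
  note per_pol = periodic_policy[OF PD(1)]
  have cheap: "cost x0 (u x0) \<le> ennreal (qf (P 0) x0)" for x0
    using u[of x0] by (intro P) (simp add: lqr_optimal_def)
  have "lyapunov_stable \<phi> (acl (policy P))"
  proof (rule lyapunov_stable_if_tendsto_zero[OF period_pos periodic_closed_loop[OF per_A per_B per_pol]])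
    fix x0
    have "traj x0 (u x0) (Suc k) = acl (policy P) k *v traj x0 (u x0) k" for k
      using cheap_control_is_riccati_feedback[OF ric st cheap, of x0 k]
      by (simp add: closed_loop_def matrix_vector_mult_add_rdistrib flip: matrix_vector_mul_assoc)
    then show "\<exists>x. x 0 = x0 \<and> (\<forall>k. x (Suc k) = acl (policy P) k *v x k) \<and> x \<longlonglongrightarrow> 0"
      using st[of x0] by (intro exI[of _ "traj x0 (u x0)"]) (simp add: stabilising_def del: state_traj.simps(2))
  qed
  then obtain S where S: "periodic \<phi> S" "\<And>k. psd (S k)" "\<And>k. loewner_ge (S k) (mat 1)"
    "\<And>k. S (Suc k) = mat 1 + congr (transpose (acl (policy P) k)) (S k)"
    using lyapunov_stable_gramian[OF period_pos periodic_closed_loop[OF per_A per_B per_pol]] by blast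
  obtain H Y where H: "sdp_feasible \<phi> X U R S H Y"
    "sdp_objective \<phi> Q S Y = (\<Sum>k<\<phi>. trace (weight (policy P) k ** S k))"
    using gramian_sdp_feasible[OF S(1,3,4)] by blast
  have "(\<Sum>k<\<phi>. trace (weight (policy P) k ** S k)) = (\<Sum>k<\<phi>. trace (P k))
      + (\<Sum>k<\<phi>. trace (P (Suc k) ** 0)) - (\<Sum>k<\<phi>. trace (0 ** S k))"
    by (rule lyapunov_trace_identity[where M = "acl (policy P)", OF PD(1) S(1)])
      (simp_all add: PD(3)[symmetric] S(4)[symmetric])
  then have "sdp_objective \<phi> Q S Y = (\<Sum>k<\<phi>. trace (P k))" using H(2) by (simp add: trace_def)
  then have "sdp_solution \<phi> X U Q R S H Y"
    using H(1) sdp_objective_ge_riccati[OF ric] unfolding sdp_solution_def by auto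
  then show ?thesis by blast
qed

end

theorem corollary2:
  fixes \<phi> :: nat
    and A :: "nat \<Rightarrow> real^'n^'n" and B :: "nat \<Rightarrow> real^'m^'n"
    and Q :: "nat \<Rightarrow> real^'n^'n" and R :: "nat \<Rightarrow> real^'m^'m"
    and X :: "nat \<Rightarrow> real^'l^'n" and U :: "nat \<Rightarrow> real^'l^'m"
  assumes "\<phi> \<ge> 1"
    and "\<forall>k. A (k + \<phi>) = A k" and "\<forall>k. B (k + \<phi>) = B k"
    and "\<forall>k<\<phi>. \<forall>j. column j (X (k + 1)) = A k *v column j (X k) + B k *v column j (U k)"
    and "\<forall>k<\<phi>. rank (vstack (X k) (U k)) = CARD('n) + CARD('m)"
    and "\<forall>k. psd (Q k)" and "\<forall>k. pd (R k)"
    and "\<forall>k. Q (k + \<phi>) = Q k" and "\<forall>k. R (k + \<phi>) = R k"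
  shows "(\<forall>S H Y K.
            sdp_solution \<phi> X U Q R S H Y \<longrightarrow>
            (\<forall>k<\<phi>. K k = U k ** H k ** matrix_inv (S k)) \<longrightarrow>
            (\<forall>k<\<phi>. \<forall>p. K (k + p * \<phi>) = K k) \<longrightarrow>
            lqr_optimal_gain A B Q R K)
       \<and> ((\<exists>K. lqr_optimal_gain A B Q R K) \<longrightarrow> (\<exists>S H Y. sdp_solution \<phi> X U Q R S H Y))"
proof -
  interpret periodic_lqr_data \<phi> A B Q R X U
  proof
    show "\<forall>k<\<phi>. X (k + 1) = A k ** X k + B k ** U k"
      using assms(4) by (blast intro: columns_dynamics_imp_matrix_dynamics)
  qed (use assms in \<open>auto simp: periodic_def\<close>)
  have per: "periodic \<phi> K" if K: "\<forall>k<\<phi>. \<forall>p. K (k + p * \<phi>) = K k" for K :: "nat \<Rightarrow> real^'n^'m"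
  proof -
    have lt: "k mod \<phi> < \<phi>" for k using assms(1) by simp
    have "K k = K (k mod \<phi>)" for k
      using K lt[of k] by (metis add.commute div_mult_mod_eq)
    then show ?thesis unfolding periodic_def by (metis mod_add_self2)
  qed
  show ?thesis
    using sdp_solution_gain_optimal per optimal_gain_imp_sdp_solution by blast
qed

end
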